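(* Let $m\ge 1$, let $X_1,X_2,\ldots$ be non-degenerate real-valued i.i.d. random variables with distribution $F$, and let $h:\mathbb{R}^m\to\mathbb{R}$ be a Borel-measurable kernel, symmetric in its arguments, with finite mean $\theta=\mathbb{E}\,h(X_1,\ldots,X_m)$. If $\mathbb{E}|h(X_1,\ldots,X_m)|^{5/3}<\infty$ and $\tilde h_1(X_1)\in DAN$, where $\tilde h_1(x)=\mathbb{E}\big(h(X_1,\ldots,X_m)-\theta\mid X_1=x\big)$, then, as $n\to\infty$, $$\frac{n-1}{m^2\,\ell^2(n)}\sum_{i=1}^n(U^i_{n-1}-U_n)^2\longrightarrow_P 1.$$
   Context: For $n\ge m$, $$U_n=\binom{n}{m}^{-1}\sum_{1\le i_1<\cdots<i_m\le n}h(X_{i_1},\ldots,X_{i_m}),$$ and for $i=1,\ldots,n$ the jackknifed version of $U_n$ (omitting $X_i$) is $$U^i_{n-1}=\binom{n-1}{m}^{-1}\sum_{\substack{1\le j_1<\cdots<j_m\le n\\ j_1,\ldots,j_m\ne i}}h(X_{j_1},\ldots,X_{j_m}).$$ Domain of attraction of the normal law: for i.i.d. random variables $Y,Y_1,Y_2,\ldots$ we write $Y\in DAN$ if there are constants $A_n$ and $B_n>0$ with $\big(\sum_{i=1}^nY_i-A_n\big)/B_n\to_d N(0,1)$ as $n\to\infty$. It is known that one can take $A_n=n\mathbb{E}(Y)$ and $B_n=n^{1/2}\ell_Y(n)$, where $\ell_Y$ is a slowly varying function at infinity determined by the law of $Y$ (with $\ell_Y(n)=\sqrt{Var(Y)}>0$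 if $Var(Y)<\infty$, and $\ell_Y(n)\to\infty$ if $Var(Y)=\infty$). Here $\ell(\cdot)$ denotes this slowly varying function for $Y=\tilde h_1(X_1)$; since $\mathbb{E}\tilde h_1(X_1)=0$, this means $\sum_{i=1}^n\tilde h_1(X_i)/(n^{1/2}\ell(n))\to_d N(0,1)$. *)

theory Defs
  imports "HOL-Probability.Probability"
begin

definition iid_seq :: "'a measure \<Rightarrow> (nat \<Rightarrow> 'a \<Rightarrow> real) \<Rightarrow> real measure \<Rightarrow> bool" where
  "iid_seq M X F \<longleftrightarrow>
     prob_space.indep_vars M (\<lambda>_. borel) X {1..} \<and> (\<forall>i\<ge>1. distr M borel (X i) = F)"

definition nondegenerate :: "'a measure \<Rightarrow> ('a \<Rightarrow> real) \<Rightarrow> bool" where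
  "nondegenerate M Y \<longleftrightarrow> \<not> (\<exists>c. AE \<omega> in M. Y \<omega> = c)"

definition conv_in_prob :: "'a measure \<Rightarrow> (nat \<Rightarrow> 'a \<Rightarrow> real) \<Rightarrow> real \<Rightarrow> bool" where
  "conv_in_prob M Z c \<longleftrightarrow>
     (\<forall>n. Z n \<in> borel_measurable M) \<and>
     (\<forall>\<epsilon>>0. (\<lambda>n. measure M {\<omega> \<in> space M. \<bar>Z n \<omega> - c\<bar> > \<epsilon>}) \<longlonglongrightarrow> 0)"

text \<open>
  A point of $R^m$ is an element of \<open>space (PiM {1..m} (\<lambda>_. borel))\<close>, that is, a function on
  the positions \<open>1, \<dots>, m\<close> which is \<open>undefined\<close> elsewhere. A permutation \<open>p permutes {1..m}\<close>
  fixes all other positions, so \<open>x \<circ> p\<close> is again such a point.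
\<close>

definition symmetric_kernel :: "nat \<Rightarrow> ((nat \<Rightarrow> real) \<Rightarrow> real) \<Rightarrow> bool" where
  "symmetric_kernel m h \<longleftrightarrow>
     (\<forall>p. p permutes {1..m} \<longrightarrow>
        (\<forall>x \<in> space (PiM {1..m} (\<lambda>_. borel :: real measure)). h (x \<circ> p) = h x))"

definition increasing_tuples :: "nat \<Rightarrow> nat set \<Rightarrow> (nat \<Rightarrow> nat) set" where
  "increasing_tuples m S = {i \<in> {1..m} \<rightarrow>\<^sub>E S. strict_mono_on {1..m} i}"

definition U_stat :: "nat \<Rightarrow> ((nat \<Rightarrow> real) \<Rightarrow> real) \<Rightarrow> (nat \<Rightarrow> real) \<Rightarrow> nat \<Rightarrow> real" where
  "U_stat m h x n =
     inverse (real (n choose m)) *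
     (\<Sum>i \<in> increasing_tuples m {1..n}. h (\<lambda>k\<in>{1..m}. x (i k)))"

text \<open>
  \<open>U_jack m h x n i\<close> is the jackknifed statistic of sample size \<open>n - 1\<close> obtained from
  \<open>x 1, \<dots>, x n\<close> by omitting \<open>x i\<close>.
\<close>

definition U_jack :: "nat \<Rightarrow> ((nat \<Rightarrow> real) \<Rightarrow> real) \<Rightarrow> (nat \<Rightarrow> real) \<Rightarrow> nat \<Rightarrow> nat \<Rightarrow> real" where
  "U_jack m h x n i =
     inverse (real ((n - 1) choose m)) *
     (\<Sum>j \<in> increasing_tuples m ({1..n} - {i}). h (\<lambda>k\<in>{1..m}. x (j k)))"

text \<open>
  \<open>g\<close> is a Borel version of the regression function \<open>x \<mapsto> E(Z | X = x)\<close>: composed with \<open>X\<close> it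
  is the conditional expectation of \<open>Z\<close> given the sigma-algebra generated by \<open>X\<close>. Such
  a function is determined only up to null sets of the law of \<open>X\<close>.
\<close>

definition is_cond_exp_given ::
    "'a measure \<Rightarrow> ('a \<Rightarrow> real) \<Rightarrow> ('a \<Rightarrow> real) \<Rightarrow> (real \<Rightarrow> real) \<Rightarrow> bool" where
  "is_cond_exp_given M Z X g \<longleftrightarrow>
     g \<in> borel_measurable borel \<and>
     (AE \<omega> in M. g (X \<omega>) = real_cond_exp M (vimage_algebra (space M) X borel) Z \<omega>)"

text \<open>
  The domain of attraction of the normal law is stated through a given i.i.d. sequence
  \<open>Y 1, Y 2, \<dots>\<close>; it depends only on the common law of the \<open>Y i\<close>.
\<close>

definition DAN :: "'a measure \<Rightarrow> (nat \<Rightarrow> 'a \<Rightarrow> real) \<Rightarrow> bool" where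
  "DAN M Y \<longleftrightarrow>
     iid_seq M Y (distr M borel (Y 1)) \<and>
     (\<exists>A B :: nat \<Rightarrow> real. (\<forall>n\<ge>1. B n > 0) \<and>
        weak_conv_m (\<lambda>n. distr M borel (\<lambda>\<omega>. ((\<Sum>i=1..n. Y i \<omega>) - A n) / B n))
          std_normal_distribution)"

definition slowly_varying :: "(real \<Rightarrow> real) \<Rightarrow> bool" where
  "slowly_varying l \<longleftrightarrow>
     set_borel_measurable borel {0<..} l \<and> (\<forall>x>0. l x > 0) \<and>
     (\<forall>c>0. ((\<lambda>x. l (c * x) / l x) \<longlongrightarrow> 1) at_top)"

text \<open>
  The slowly varying function attached to a law in the domain of attraction of the normal law.
  It is pinned down by the law only up to asymptotic equivalence of its values at the natural
  numbers, so it is a predicate rather than a function of the law.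
\<close>

definition DAN_slowly_varying ::
    "'a measure \<Rightarrow> (nat \<Rightarrow> 'a \<Rightarrow> real) \<Rightarrow> (real \<Rightarrow> real) \<Rightarrow> bool" where
  "DAN_slowly_varying M Y l \<longleftrightarrow>
     slowly_varying l \<and>
     weak_conv_m
       (\<lambda>n. distr M borel (\<lambda>\<omega>.
          ((\<Sum>i=1..n. Y i \<omega>) - real n * prob_space.expectation M (Y 1)) /
          (sqrt (real n) * l (real n))))
       std_normal_distribution \<and>
     (if integrable M (\<lambda>\<omega>. (Y 1 \<omega>)\<^sup>2)
      then \<forall>n\<ge>1. l (real n) = sqrt (prob_space.variance M (Y 1))
      else filterlim (\<lambda>n. l (real n)) at_top sequentially)"

end

theory Submission
  imports Defs
begin

text \<open>
  Write \<open>v\<^sub>i\<close> for the average of the kernel over all \<open>m\<close>-subsets of the sample that contain \<open>X\<^sub>i\<close>.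
  Then \<open>U\<^sup>i\<^sub>n\<^sub>-\<^sub>1 - U\<^sub>n\<close> equals \<open>m / (n - m)\<close> times the mean of the \<open>v\<^sub>k\<close> minus \<open>v\<^sub>i\<close>, so the
  statistic is, up to a factor tending to 1, the sample variance of the \<open>v\<^sub>i\<close> divided by the
  square of the slowly varying function.

  The \<open>v\<^sub>i\<close> may be replaced by \<open>h\<^sub>1(X\<^sub>i) + \<theta>\<close>: truncate the kernel at height \<open>n\<close>. The deviations
  of the truncated kernel from its conditional mean given \<open>X\<^sub>i\<close> are uncorrelated for subsets that
  share only \<open>X\<^sub>i\<close>, so the mean squared error is of order \<open>n\<^sup>-\<^sup>1\<close> times the truncated second moment,
  which is at most of order \<open>n\<^sup>1\<^sup>/\<^sup>3\<close>; the remaining part is small in \<open>L\<^sup>1\<close>, since its first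
  moment is of order \<open>n\<^sup>-\<^sup>2\<^sup>/\<^sup>3\<close>.

  For the \<open>h\<^sub>1(X\<^sub>i)\<close> the claim is Raikov's theorem: for centred \<open>Y\<^sub>i\<close>, convergence of the normed
  sums \<open>(Y\<^sub>1 + \<dots> + Y\<^sub>n) / B\<^sub>n\<close> to the normal law forces
  \<open>(Y\<^sub>1\<^sup>2 + \<dots> + Y\<^sub>n\<^sup>2) / B\<^sub>n\<^sup>2 \<rightarrow> 1\<close> in probability. Indeed
  \<open>n (1 - Re \<phi>(t / B\<^sub>n)) \<rightarrow> t\<^sup>2 / 2\<close>, and integrating \<open>t\<close> against a Gaussian law turns this into the
  convergence of the Laplace transforms of the normed sums of squares to \<open>exp (- s)\<close>.
\<close>

section \<open>Convergence in probability\<close>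

lemma conv_in_prob_measurable: "conv_in_prob M Z c \<Longrightarrow> Z n \<in> borel_measurable M"
  by (simp add: conv_in_prob_def)

lemma conv_in_probD:
  "conv_in_prob M Z c \<Longrightarrow> \<epsilon> > 0 \<Longrightarrow>
    (\<lambda>n. measure M {\<omega> \<in> space M. \<bar>Z n \<omega> - c\<bar> > \<epsilon>}) \<longlonglongrightarrow> 0"
  by (simp add: conv_in_prob_def)

context prob_space
begin

text \<open>Up to a null set, the event that \<open>Z n\<close> is far from \<open>c\<close> lies in
  the event that \<open>W n\<close> is far from 0. The bound is asked only eventually and almost
  surely: conditional means are fixed only almost surely, and the counting estimates need
  \<open>n \<ge> m\<close>.\<close>

lemma conv_in_prob_dominated:
  assumes [measurable]: "\<And>n. Z n \<in> borel_measurable M"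
    and W: "conv_in_prob M W 0"
    and le: "eventually (\<lambda>n. AE \<omega> in M. \<bar>Z n \<omega> - c\<bar> \<le> W n \<omega>) sequentially"
  shows "conv_in_prob M Z c"
  unfolding conv_in_prob_def
proof (intro conjI allI impI)
  note [measurable] = conv_in_prob_measurable[OF W]
  fix \<epsilon> :: real assume "\<epsilon> > 0"
  show "(\<lambda>n. prob {\<omega> \<in> space M. \<bar>Z n \<omega> - c\<bar> > \<epsilon>}) \<longlonglongrightarrow> 0"
  proof (rule tendsto_sandwich[OF _ _ tendsto_const conv_in_probD[OF W \<open>\<epsilon> > 0\<close>]])
    show "\<forall>\<^sub>F n in sequentially. prob {\<omega> \<in> space M. \<epsilon> < \<bar>Z n \<omega> - c\<bar>}
        \<le> prob {\<omega> \<in> space M. \<epsilon> < \<bar>W n \<omega> - 0\<bar>}"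
      using le
    proof eventually_elim
      case (elim n)
      show ?case
        by (rule finite_measure_mono_AE) (use elim in \<open>auto elim!: eventually_mono\<close>)
    qed
  qed (simp add: measure_nonneg)
qed simp

lemma conv_in_prob_cong:
  assumes "\<And>n. Z n \<in> borel_measurable M"
    and W: "conv_in_prob M W c"
    and eq: "eventually (\<lambda>n. \<forall>\<omega>\<in>space M. Z n \<omega> = W n \<omega>) sequentially"
  shows "conv_in_prob M Z c"
  unfolding conv_in_prob_def
proof (intro conjI allI impI)
  fix \<epsilon> :: real assume "\<epsilon> > 0"
  show "(\<lambda>n. prob {\<omega> \<in> space M. \<bar>Z n \<omega> - c\<bar> > \<epsilon>}) \<longlonglongrightarrow> 0"
  proof (rule Lim_transform_eventually[OF conv_in_probD[OF W \<open>\<epsilon> > 0\<close>]])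
    show "\<forall>\<^sub>F n in sequentially. prob {\<omega> \<in> space M. \<epsilon> < \<bar>W n \<omega> - c\<bar>}
        = prob {\<omega> \<in> space M. \<epsilon> < \<bar>Z n \<omega> - c\<bar>}"
      using eq by eventually_elim (rule arg_cong[where f=prob], auto)
  qed
qed fact

lemma conv_in_prob_const:
  assumes "a \<longlonglongrightarrow> c"
  shows "conv_in_prob M (\<lambda>n \<omega>. a n) c"
  unfolding conv_in_prob_def
proof (intro conjI allI impI)
  fix \<epsilon> :: real assume "\<epsilon> > 0"
  with assms have "\<forall>\<^sub>F n in sequentially. dist (a n) c < \<epsilon>" by (rule tendstoD)
  then have "\<forall>\<^sub>F n in sequentially. prob {\<omega> \<in> space M. \<epsilon> < \<bar>a n - c\<bar>} = 0"
    by eventually_elim (simp add: dist_real_def)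
  then show "(\<lambda>n. prob {\<omega> \<in> space M. \<epsilon> < \<bar>a n - c\<bar>}) \<longlonglongrightarrow> 0"
    by (rule tendsto_eventually)
qed simp

text \<open>Continuous mapping for constant limits. Continuity at the one point
  \<open>(a, b)\<close> suffices, because the pair is close to it except on two events of vanishing
  probability.\<close>

lemma conv_in_prob_cont2:
  fixes f :: "real \<times> real \<Rightarrow> real"
  assumes A: "conv_in_prob M A a" and B: "conv_in_prob M B b"
    and f: "isCont f (a, b)" and [measurable]: "f \<in> borel_measurable borel"
  shows "conv_in_prob M (\<lambda>n \<omega>. f (A n \<omega>, B n \<omega>)) (f (a, b))"
  unfolding conv_in_prob_def
proof (intro conjI allI impI)
  note [measurable] = conv_in_prob_measurable[OF A] conv_in_prob_measurable[OF B]
  show "(\<lambda>\<omega>. f (A n \<omega>, B n \<omega>)) \<in> borel_measurable M" for n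
    by measurable
  fix \<epsilon> :: real assume "\<epsilon> > 0"
  with f obtain d where d: "d > 0" "\<And>x. dist x (a, b) < d \<Longrightarrow> dist (f x) (f (a, b)) < \<epsilon>"
    unfolding continuous_at_eps_delta by metis
  \<comment> \<open>The distance in the plane is at most the sum of the coordinate distances, so two
    thirds of \<open>d\<close> stay strictly below \<open>d\<close>.\<close>
  have d': "\<bar>f (x, y) - f (a, b)\<bar> \<le> \<epsilon>" if "\<bar>x - a\<bar> \<le> d/3" "\<bar>y - b\<bar> \<le> d/3" for x y
  proof -
    have "dist (x, y) (a, b) \<le> \<bar>x - a\<bar> + \<bar>y - b\<bar>"
      using sqrt_sum_squares_le_sum_abs by (simp add: dist_Pair_Pair dist_real_def)
    then show ?thesis using that d(1) d(2)[of "(x, y)"] by (simp add: dist_real_def)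
  qed
  have "d/3 > 0" using d by simp
  show "(\<lambda>n. prob {\<omega> \<in> space M. \<bar>f (A n \<omega>, B n \<omega>) - f (a, b)\<bar> > \<epsilon>}) \<longlonglongrightarrow> 0"
  proof (rule tendsto_sandwich[OF _ _ tendsto_const])
    show "(\<lambda>n. prob {\<omega> \<in> space M. \<bar>A n \<omega> - a\<bar> > d/3} + prob {\<omega> \<in> space M. \<bar>B n \<omega> - b\<bar> > d/3})
        \<longlonglongrightarrow> 0"
      using tendsto_add[OF conv_in_probD[OF A \<open>d/3 > 0\<close>] conv_in_probD[OF B \<open>d/3 > 0\<close>]] by simp
    show "\<forall>\<^sub>F n in sequentially. prob {\<omega> \<in> space M. \<bar>f (A n \<omega>, B n \<omega>) - f (a, b)\<bar> > \<epsilon>}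
       \<le> prob {\<omega> \<in> space M. \<bar>A n \<omega> - a\<bar> > d/3} + prob {\<omega> \<in> space M. \<bar>B n \<omega> - b\<bar> > d/3}"
    proof (intro always_eventually allI)
      fix n
      have "prob {\<omega> \<in> space M. \<bar>f (A n \<omega>, B n \<omega>) - f (a, b)\<bar> > \<epsilon>}
        \<le> prob ({\<omega> \<in> space M. \<bar>A n \<omega> - a\<bar> > d/3} \<union> {\<omega> \<in> space M. \<bar>B n \<omega> - b\<bar> > d/3})"
        using d' by (intro finite_measure_mono) (auto simp: not_less[symmetric] intro: ccontr)
      also have "\<dots> \<le> prob {\<omega> \<in> space M. \<bar>A n \<omega> - a\<bar> > d/3} + prob {\<omega> \<in> space M. \<bar>B n \<omega> - b\<bar> > d/3}"
        by (intro measure_subadditive) (auto simp: emeasure_eq_measure)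
      finally show "prob {\<omega> \<in> space M. \<bar>f (A n \<omega>, B n \<omega>) - f (a, b)\<bar> > \<epsilon>}
       \<le> prob {\<omega> \<in> space M. \<bar>A n \<omega> - a\<bar> > d/3} + prob {\<omega> \<in> space M. \<bar>B n \<omega> - b\<bar> > d/3}" .
    qed
  qed (simp add: measure_nonneg)
qed

lemma conv_in_prob_cont:
  fixes f :: "real \<Rightarrow> real"
  assumes A: "conv_in_prob M A a" and f: "isCont f a" and [measurable]: "f \<in> borel_measurable borel"
  shows "conv_in_prob M (\<lambda>n \<omega>. f (A n \<omega>)) (f a)"
proof -
  have "isCont (\<lambda>x. f (fst x)) (a, a)"
    using f by (intro isCont_o2[where f=fst and g=f]) auto
  moreover have "(\<lambda>x :: real \<times> real. f (fst x)) \<in> borel_measurable borel"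
    unfolding borel_prod[symmetric] by measurable
  ultimately show ?thesis
    using conv_in_prob_cont2[OF A A, of "\<lambda>x. f (fst x)"] by simp
qed

lemma conv_in_prob_add:
  assumes "conv_in_prob M A a" "conv_in_prob M B b"
  shows "conv_in_prob M (\<lambda>n \<omega>. A n \<omega> + B n \<omega>) (a + b)"
  using conv_in_prob_cont2[OF assms, of "\<lambda>x. fst x + snd x"]
  by (simp add: borel_prod[symmetric])

lemma conv_in_prob_mult:
  assumes "conv_in_prob M A a" "conv_in_prob M B b"
  shows "conv_in_prob M (\<lambda>n \<omega>. A n \<omega> * B n \<omega>) (a * b)"
  using conv_in_prob_cont2[OF assms, of "\<lambda>x. fst x * snd x"]
  by (simp add: borel_prod[symmetric])

text \<open>Markov's inequality. Integrability is a separate condition because the Bochner integral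
  of a function that is not integrable is 0, so the limit alone would say nothing.\<close>

lemma conv_in_prob_L1:
  assumes [measurable]: "\<And>n. Z n \<in> borel_measurable M"
    and int: "eventually (\<lambda>n. integrable M (Z n)) sequentially"
    and lim: "(\<lambda>n. expectation (\<lambda>\<omega>. \<bar>Z n \<omega>\<bar>)) \<longlonglongrightarrow> 0"
  shows "conv_in_prob M Z 0"
  unfolding conv_in_prob_def
proof (intro conjI allI impI)
  fix \<epsilon> :: real assume "\<epsilon> > 0"
  show "(\<lambda>n. prob {\<omega> \<in> space M. \<bar>Z n \<omega> - 0\<bar> > \<epsilon>}) \<longlonglongrightarrow> 0"
  proof (rule tendsto_sandwich[OF _ _ tendsto_const])
    show "(\<lambda>n. expectation (\<lambda>\<omega>. \<bar>Z n \<omega>\<bar>) / \<epsilon>) \<longlonglongrightarrow> 0"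
      using tendsto_divide[OF lim tendsto_const[of \<epsilon>]] \<open>\<epsilon> > 0\<close> by simp
    show "\<forall>\<^sub>F n in sequentially. prob {\<omega> \<in> space M. \<bar>Z n \<omega> - 0\<bar> > \<epsilon>} \<le> expectation (\<lambda>\<omega>. \<bar>Z n \<omega>\<bar>) / \<epsilon>"
      using int
    proof eventually_elim
      case (elim n)
      have "prob {\<omega> \<in> space M. \<bar>Z n \<omega> - 0\<bar> > \<epsilon>} \<le> prob {\<omega> \<in> space M. \<epsilon> \<le> \<bar>Z n \<omega>\<bar>}"
        by (intro finite_measure_mono) auto
      also have "\<dots> \<le> expectation (\<lambda>\<omega>. \<bar>Z n \<omega>\<bar>) / \<epsilon>"
        using elim \<open>\<epsilon> > 0\<close> by (intro integral_Markov_inequality_measure[where A="{}"]) auto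
      finally show ?case .
    qed
  qed (simp add: measure_nonneg)
qed simp

end

section \<open>Raikov's theorem\<close>

lemma abs_sin_minus_le: "\<bar>sin x - x\<bar> \<le> x\<^sup>2 / 2" for x :: real
proof -
  have "\<bar>sin x - x\<bar> = \<bar>Im (iexp x - (\<Sum>k\<le>1. (\<i> * complex_of_real x)^k / fact k))\<bar>"
    by (simp add: Im_exp)
  also have "\<dots> \<le> cmod (iexp x - (\<Sum>k\<le>1. (\<i> * complex_of_real x)^k / fact k))"
    by (rule abs_Im_le_cmod)
  also have "\<dots> \<le> x\<^sup>2 / 2"
    using iexp_approx1[of x 1] by (simp add: numeral_2_eq_2)
  finally show ?thesis .
qed

lemma one_minus_cos_double: "1 - cos x = 2 * (sin (x / 2))\<^sup>2" for x :: real
  using cos_double_sin[of "x / 2"] by simp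

text \<open>By the half-angle formula this is the square of
  \<open>|sin (a - b)| \<le> |sin a| + |sin b|\<close>. Integrated against a law, it moves a bound
  on \<open>1 - Re \<phi>\<close> from an arbitrary interval to one around 0.\<close>

lemma one_minus_cos_add_le: "1 - cos (x - y) \<le> 2 * (1 - cos x) + 2 * (1 - cos y)" for x y :: real
proof -
  have "\<bar>sin (x/2 - y/2)\<bar> \<le> \<bar>sin (x/2)\<bar> + \<bar>sin (y/2)\<bar>"
  proof -
    have "\<bar>sin (x/2 - y/2)\<bar> \<le> \<bar>sin (x/2)\<bar> * \<bar>cos (y/2)\<bar> + \<bar>cos (x/2)\<bar> * \<bar>sin (y/2)\<bar>"
      unfolding sin_diff abs_mult[symmetric] by linarith
    also have "\<dots> \<le> \<bar>sin (x/2)\<bar> * 1 + 1 * \<bar>sin (y/2)\<bar>"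
      by (intro add_mono mult_left_mono mult_right_mono) auto
    finally show ?thesis by simp
  qed
  then have "(sin (x/2 - y/2))\<^sup>2 \<le> (\<bar>sin (x/2)\<bar> + \<bar>sin (y/2)\<bar>)\<^sup>2"
    by (metis abs_ge_zero power2_abs power_mono)
  also have "\<dots> \<le> 2 * (sin (x/2))\<^sup>2 + 2 * (sin (y/2))\<^sup>2"
    using sum_squares_bound[of "\<bar>sin (x/2)\<bar>" "\<bar>sin (y/2)\<bar>"] by (simp add: power2_sum)
  finally show ?thesis
    by (simp add: one_minus_cos_double diff_divide_distrib)
qed

lemma abs_sin_mult_le: "\<bar>sin (real n * x)\<bar> \<le> real n * \<bar>sin x\<bar>"
proof (induction n)
  case (Suc n)
  have "\<bar>sin (real (Suc n) * x)\<bar> = \<bar>sin (real n * x) * cos x + cos (real n * x) * sin x\<bar>"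
    using sin_add[of "real n * x" x] by (simp add: distrib_right add.commute)
  also have "\<dots> \<le> \<bar>sin (real n * x)\<bar> * \<bar>cos x\<bar> + \<bar>cos (real n * x)\<bar> * \<bar>sin x\<bar>"
    unfolding abs_mult[symmetric] by linarith
  also have "\<dots> \<le> \<bar>sin (real n * x)\<bar> * 1 + 1 * \<bar>sin x\<bar>"
    by (intro add_mono mult_left_mono mult_right_mono) auto
  finally show ?case using Suc by (simp add: algebra_simps)
qed simp

text \<open>Growth along integer multiples is at most quadratic; this extends a bound near 0 to the
  whole line.\<close>

lemma one_minus_cos_mult_le: "1 - cos (real n * x) \<le> (real n)\<^sup>2 * (1 - cos x)"
proof -
  have "(sin (real n * (x / 2)))\<^sup>2 \<le> (real n * \<bar>sin (x / 2)\<bar>)\<^sup>2"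
    using abs_sin_mult_le[of n "x/2"] by (metis abs_ge_zero power2_abs power_mono)
  then show ?thesis
    by (simp add: one_minus_cos_double power_mult_distrib)
qed

text \<open>Applying \<open>ln x \<le> x - 1\<close> to \<open>a n\<close> and to its reciprocal
  squeezes \<open>n * (1 - a n)\<close> between \<open>- a n * n * ln (a n)\<close> and
  \<open>- n * ln (a n)\<close>; both have the limit \<open>L\<close> because \<open>a n\<close>
  tends to 1.\<close>

lemma nth_power_tendsto_imp_rate:
  fixes a :: "nat \<Rightarrow> real"
  assumes a: "\<And>n. a n \<le> 1" "\<And>n. 0 \<le> a n" and lim: "(\<lambda>n. a n ^ n) \<longlonglongrightarrow> exp (- L)"
  shows "(\<lambda>n. real n * (1 - a n)) \<longlonglongrightarrow> L"
proof -
  have pos: "eventually (\<lambda>n. a n > 0 \<and> n > 0) sequentially"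
  proof -
    have "eventually (\<lambda>n. a n ^ n > 0) sequentially"
      using order_tendstoD(1)[OF lim, of 0] by simp
    then show ?thesis
      using eventually_gt_at_top[of 0]
      by eventually_elim (metis a(2) order_le_less zero_power less_irrefl)
  qed
  have "(\<lambda>n. ln (a n ^ n)) \<longlonglongrightarrow> ln (exp (- L))"
    by (intro tendsto_ln lim) simp
  then have lim1: "(\<lambda>n. real n * ln (a n)) \<longlonglongrightarrow> - L"
    using pos by (simp, elim Lim_transform_eventually) (auto elim!: eventually_mono simp: ln_realpow)
  \<comment> \<open>This expression is \<open>a n\<close> itself, so the convergence of
    \<open>n * ln (a n)\<close> forces \<open>a n\<close> to 1.\<close>
  have "(\<lambda>n. exp ((real n * ln (a n)) * (1 / real n))) \<longlonglongrightarrow> exp (- L * 0)"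
    by (intro tendsto_exp tendsto_mult lim1 lim_1_over_n)
  then have "a \<longlonglongrightarrow> exp (- L * 0)"
    using pos by (elim Lim_transform_eventually) (auto elim!: eventually_mono)
  then have lim2: "a \<longlonglongrightarrow> 1" by simp
  show ?thesis
  proof (rule tendsto_sandwich)
    show "(\<lambda>n. - (a n * (real n * ln (a n)))) \<longlonglongrightarrow> L"
      using tendsto_minus[OF tendsto_mult[OF lim2 lim1]] by simp
    show "(\<lambda>n. - (real n * ln (a n))) \<longlonglongrightarrow> L"
      using tendsto_minus[OF lim1] by simp
    show "\<forall>\<^sub>F n in sequentially. real n * (1 - a n) \<le> - (real n * ln (a n))"
      using pos
    proof eventually_elim
      case (elim n)
      then have "real n * ln (a n) \<le> real n * (a n - 1)"
        by (intro mult_left_mono ln_le_minus_one) auto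
      then show ?case by (simp add: algebra_simps)
    qed
    show "\<forall>\<^sub>F n in sequentially. - (a n * (real n * ln (a n))) \<le> real n * (1 - a n)"
      using pos
    proof eventually_elim
      case (elim n)
      then have "ln (1 / a n) \<le> 1 / a n - 1" by (intro ln_le_minus_one) auto
      then have "a n * (- ln (a n)) \<le> a n * (1 / a n - 1)"
        using elim by (intro mult_left_mono) (auto simp: ln_div)
      also have "a n * (1 / a n - 1) = 1 - a n"
        using elim by (simp add: right_diff_distrib)
      finally have "a n * (- ln (a n)) \<le> 1 - a n" .
      from mult_left_mono[OF this, of "real n"] show ?case by (simp add: algebra_simps)
    qed
  qed
qed

text \<open>The converse passage, by the same two logarithmic bounds. The rate already forces
  \<open>a n\<close> to 1, so the logarithm is available for large \<open>n\<close>.\<close>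

lemma rate_imp_nth_power_tendsto:
  fixes a :: "nat \<Rightarrow> real"
  assumes lim: "(\<lambda>n. real n * (1 - a n)) \<longlonglongrightarrow> L"
  shows "(\<lambda>n. a n ^ n) \<longlonglongrightarrow> exp (- L)"
proof -
  have "(\<lambda>n. (real n * (1 - a n)) * (1 / real n)) \<longlonglongrightarrow> L * 0"
    by (intro tendsto_mult lim lim_1_over_n)
  then have "(\<lambda>n. 1 - a n) \<longlonglongrightarrow> L * 0"
    by (rule Lim_transform_eventually)
      (use eventually_gt_at_top[of "0::nat"] in \<open>eventually_elim, simp\<close>)
  then have "(\<lambda>n. 1 - (1 - a n)) \<longlonglongrightarrow> 1 - L * 0"
    by (intro tendsto_diff tendsto_const)
  then have lim2: "a \<longlonglongrightarrow> 1" by simp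
  have pos: "eventually (\<lambda>n. a n > 0) sequentially"
    using order_tendstoD(1)[OF lim2, of 0] by simp
  have "(\<lambda>n. real n * ln (a n)) \<longlonglongrightarrow> - L"
  proof (rule tendsto_sandwich)
    show "(\<lambda>n. - (real n * (1 - a n) / a n)) \<longlonglongrightarrow> - L"
      using tendsto_minus[OF tendsto_divide[OF lim lim2]] by simp
    show "(\<lambda>n. - (real n * (1 - a n))) \<longlonglongrightarrow> - L"
      by (intro tendsto_minus lim)
    show "\<forall>\<^sub>F n in sequentially. real n * ln (a n) \<le> - (real n * (1 - a n))"
      using pos
    proof eventually_elim
      case (elim n)
      then have "real n * ln (a n) \<le> real n * (a n - 1)"
        by (intro mult_left_mono ln_le_minus_one) auto
      then show ?case by (simp add: algebra_simps)
    qed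
    show "\<forall>\<^sub>F n in sequentially. - (real n * (1 - a n) / a n) \<le> real n * ln (a n)"
      using pos
    proof eventually_elim
      case (elim n)
      then have "ln (1 / a n) \<le> 1 / a n - 1" by (intro ln_le_minus_one) auto
      then have "- ln (a n) \<le> (1 - a n) / a n"
        using elim by (simp add: ln_div diff_divide_distrib)
      from mult_left_mono[OF this, of "real n"] show ?case by (simp add: algebra_simps)
    qed
  qed
  then have "(\<lambda>n. exp (real n * ln (a n))) \<longlonglongrightarrow> exp (- L)"
    by (rule tendsto_exp)
  then show ?thesis
    using pos
    by (elim Lim_transform_eventually)
      (auto elim!: eventually_mono simp: exp_of_nat_mult)
qed

text \<open>The closed sets on which all \<open>f n\<close> are at most \<open>K\<close> cover the
  line as \<open>K\<close> grows, so by Baire one of them contains an interval.\<close>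

lemma pointwise_bounded_imp_bounded_interval:
  fixes f :: "nat \<Rightarrow> real \<Rightarrow> real"
  assumes cont: "\<And>n. continuous_on UNIV (f n)"
    and bdd: "\<And>t. \<exists>C. \<forall>n. f n t \<le> C"
  shows "\<exists>a d C. d > 0 \<and> (\<forall>n. \<forall>t\<in>ball a d. f n t \<le> C)"
proof (rule ccontr)
  assume contra: "\<not> ?thesis"
  define A where "A = (\<lambda>K :: nat. {t. \<forall>n. f n t \<le> real K})"
  have "closed (A K)" for K
  proof -
    have "A K = (\<Inter>n. {t. f n t \<le> real K})" by (auto simp: A_def)
    then show ?thesis
      using cont by (auto intro!: closed_Collect_le)
  qed
  moreover have "interior (A K) = {}" for K
  proof (rule ccontr)
    assume "interior (A K) \<noteq> {}"
    then obtain a d where "d > 0" "ball a d \<subseteq> A K"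
      by (meson all_not_in_conv mem_interior)
    then have "\<forall>n. \<forall>t\<in>ball a d. f n t \<le> real K" by (auto simp: A_def)
    with contra \<open>d > 0\<close> show False by blast
  qed
  \<comment> \<open>If no \<open>A K\<close> had interior points, their complements would be open
    and dense and hence have a dense intersection; but that intersection is empty.\<close>
  ultimately have "UNIV \<subseteq> closure (\<Inter>(range (\<lambda>K. - A K)))"
    by (intro Baire) (auto simp: closure_complement)
  moreover have "\<Inter>(range (\<lambda>K. - A K)) = {}"
  proof -
    have "\<exists>K. t \<in> A K" for t
    proof -
      from bdd obtain C where "\<forall>n. f n t \<le> C" by blast
      moreover obtain K where "C \<le> real K" using real_arch_simple by blast
      ultimately show ?thesis by (auto simp: A_def intro: order_trans)
    qed
    then show ?thesis by auto
  qed
  ultimately show False by (simp add: closure_empty)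
qed

section \<open>Characteristic functions near the origin\<close>

lemma (in real_distribution) Re_char: "Re (char M t) = (\<integral>x. cos (t * x) \<partial>M)"
  and Im_char: "Im (char M t) = (\<integral>x. sin (t * x) \<partial>M)"
proof -
  have "integrable M (\<lambda>x. iexp (t * x))" by (rule integrable_iexp) auto
  then show "Re (char M t) = (\<integral>x. cos (t * x) \<partial>M)" "Im (char M t) = (\<integral>x. sin (t * x) \<partial>M)"
    unfolding char_def
    by (simp_all add: integral_Re[symmetric] integral_Im[symmetric] Re_exp Im_exp del: integral_Re integral_Im)
qed

lemma (in real_distribution) integrable_cos: "integrable M (\<lambda>x. cos (t * x))"
  by (rule integrable_const_bound[where B=1]) auto

lemma (in real_distribution) integrable_sin: "integrable M (\<lambda>x. sin (t * x))"
  by (rule integrable_const_bound[where B=1]) auto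

lemma (in real_distribution) one_minus_Re_char: "1 - Re (char M t) = (\<integral>x. 1 - cos (t * x) \<partial>M)"
  using integrable_cos by (subst Bochner_Integration.integral_diff) (auto simp: Re_char prob_space[simplified])

text \<open>A positive lower bound for \<open>b\<close> makes the norming at least
  \<open>c * sqrt n\<close>. The slowly varying function supplies such a bound, being constant or
  divergent along the positive integers.\<close>

lemma tendsto_inverse_norming:
  assumes "c > 0" "\<And>n. b n \<ge> c"
  shows "(\<lambda>n. t / (sqrt (real n) * b n)) \<longlonglongrightarrow> 0"
proof (rule Lim_null_comparison)
  show "(\<lambda>n. \<bar>t\<bar> / c * (1 / sqrt (real n))) \<longlonglongrightarrow> 0"
    by (intro tendsto_mult_right_zero tendsto_divide_0[OF tendsto_const] filterlim_at_top_imp_at_infinity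
        filterlim_compose[OF sqrt_at_top filterlim_real_sequentially])
  show "\<forall>\<^sub>F n in sequentially. norm (t / (sqrt (real n) * b n)) \<le> \<bar>t\<bar> / c * (1 / sqrt (real n))"
    using eventually_gt_at_top[of 0]
  proof eventually_elim
    case (elim n)
    have "b n > 0" using assms(1) assms(2)[of n] by linarith
    have "\<bar>t\<bar> / (sqrt (real n) * b n) \<le> \<bar>t\<bar> / (sqrt (real n) * c)"
      using assms elim \<open>b n > 0\<close> by (intro divide_left_mono mult_left_mono) auto
    then show ?case using \<open>b n > 0\<close> by (simp add: abs_mult field_simps)
  qed
qed

text \<open>
  The only place where the centring of the law enters: it lets one subtract the linear term
  from \<open>sin\<close>, which makes the integrand dominated by a multiple of \<open>\<bar>x\<bar>\<close>.
\<close>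

lemma (in real_distribution) Im_char_centred:
  assumes int: "integrable M (\<lambda>x. x)" and mean: "(\<integral>x. x \<partial>M) = 0"
    and b: "c > 0" "\<And>n. b n \<ge> c"
  shows "(\<lambda>n. sqrt (real n) * Im (char M (t / (sqrt (real n) * b n)))) \<longlonglongrightarrow> 0"
proof -
  define s where "s = (\<lambda>n. t / (sqrt (real n) * b n))"
  have bpos: "b n > 0" for n using b(1) b(2)[of n] by linarith
  have s0: "s \<longlonglongrightarrow> 0" unfolding s_def by (rule tendsto_inverse_norming[OF b])
  have ss: "\<bar>sqrt (real n) * s n\<bar> \<le> \<bar>t\<bar> / c" for n
  proof (cases "n = 0")
    case False
    then have "\<bar>sqrt (real n) * s n\<bar> = \<bar>t\<bar> / b n"
      using bpos[of n] by (simp add: s_def abs_mult)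
    also have "\<dots> \<le> \<bar>t\<bar> / c" using b bpos[of n] by (intro divide_left_mono) auto
    finally show ?thesis .
  qed (use b in auto)
  have lim: "(\<lambda>n. \<integral>x. sqrt (real n) * (sin (s n * x) - s n * x) \<partial>M) \<longlonglongrightarrow> (\<integral>x. 0 \<partial>M)"
  proof (rule integral_dominated_convergence[where w="\<lambda>x. 2 * (\<bar>t\<bar> / c) * \<bar>x\<bar>"])
    show "AE x in M. (\<lambda>n. sqrt (real n) * (sin (s n * x) - s n * x)) \<longlonglongrightarrow> 0"
    proof (rule AE_I2, rule Lim_null_comparison, intro always_eventually allI)
      fix x n
      \<comment> \<open>The quadratic error contains \<open>s n\<close> twice: one factor absorbs
        \<open>sqrt n\<close>, the other tends to 0.\<close>
      have "\<bar>sqrt (real n) * (sin (s n * x) - s n * x)\<bar> \<le> sqrt (real n) * ((s n * x)\<^sup>2 / 2)"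
        unfolding abs_mult using abs_sin_minus_le[of "s n * x"] by (intro mult_mono) auto
      also have "\<dots> \<le> sqrt (real n) * (s n * x)\<^sup>2"
        by (intro mult_left_mono) auto
      also have "\<dots> = \<bar>sqrt (real n) * s n\<bar> * (\<bar>s n\<bar> * x\<^sup>2)"
        by (simp add: abs_mult power_mult_distrib) (simp add: power2_eq_square)
      also have "\<dots> \<le> (\<bar>t\<bar> / c) * (\<bar>s n\<bar> * x\<^sup>2)"
        by (intro mult_right_mono ss) auto
      finally show "norm (sqrt (real n) * (sin (s n * x) - s n * x)) \<le> (\<bar>t\<bar> / c) * (\<bar>s n\<bar> * x\<^sup>2)" by simp
    next
      fix x
      have "(\<lambda>n. (\<bar>t\<bar> / c) * (\<bar>s n\<bar> * x\<^sup>2)) \<longlonglongrightarrow> (\<bar>t\<bar> / c) * (\<bar>0\<bar> * x\<^sup>2)"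
        by (intro tendsto_intros s0)
      then show "(\<lambda>n. (\<bar>t\<bar> / c) * (\<bar>s n\<bar> * x\<^sup>2)) \<longlonglongrightarrow> 0" by simp
    qed
  next
    fix n
    show "AE x in M. norm (sqrt (real n) * (sin (s n * x) - s n * x)) \<le> 2 * (\<bar>t\<bar> / c) * \<bar>x\<bar>"
    proof (rule AE_I2)
      fix x
      \<comment> \<open>The quadratic bound cannot dominate, since the second moment may be
        infinite; the linear one needs only the first moment.\<close>
      have "\<bar>sin (s n * x) - s n * x\<bar> \<le> 2 * \<bar>s n * x\<bar>"
        using abs_sin_x_le_abs_x[of "s n * x"] by linarith
      then have "\<bar>sqrt (real n) * (sin (s n * x) - s n * x)\<bar> \<le> sqrt (real n) * (2 * \<bar>s n * x\<bar>)"
        unfolding abs_mult by (simp add: mult_left_mono)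
      also have "\<dots> = 2 * \<bar>sqrt (real n) * s n\<bar> * \<bar>x\<bar>" by (simp add: abs_mult)
      also have "\<dots> \<le> 2 * (\<bar>t\<bar> / c) * \<bar>x\<bar>" by (intro mult_right_mono mult_left_mono ss) auto
      finally show "norm (sqrt (real n) * (sin (s n * x) - s n * x)) \<le> 2 * (\<bar>t\<bar> / c) * \<bar>x\<bar>" by simp
    qed
  next
    show "integrable M (\<lambda>x. 2 * (\<bar>t\<bar> / c) * \<bar>x\<bar>)"
      by (intro integrable_mult_right integrable_abs int)
  qed measurable
  have eq: "(\<integral>x. sqrt (real n) * (sin (s n * x) - s n * x) \<partial>M) = sqrt (real n) * Im (char M (s n))" for n
    using int integrable_sin[of "s n"] mean
    by (simp add: Bochner_Integration.integral_diff Im_char)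
  show ?thesis using lim unfolding eq by (simp add: s_def)
qed

text \<open>Complex logarithms are avoided by passing to \<open>|\<phi>|^2\<close>, whose nth power
  tends to \<open>exp (- t^2)\<close> and so yields the rate \<open>t^2\<close>. As
  \<open>|\<phi>|^2 = Re^2 + Im^2\<close> and \<open>n * Im^2\<close> vanishes by centring,
  \<open>n * (1 - Re) * (1 + Re)\<close> has the same limit, while \<open>1 + Re\<close> tends to
  2.\<close>

lemma (in real_distribution) Re_char_rate:
  assumes int: "integrable M (\<lambda>x. x)" and mean: "(\<integral>x. x \<partial>M) = 0"
    and b: "c > 0" "\<And>n. b n \<ge> c"
    and lim: "(\<lambda>n. char M (t / (sqrt (real n) * b n)) ^ n) \<longlonglongrightarrow> complex_of_real (exp (- t\<^sup>2 / 2))"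
  shows "(\<lambda>n. real n * (1 - Re (char M (t / (sqrt (real n) * b n))))) \<longlonglongrightarrow> t\<^sup>2 / 2"
proof -
  define \<phi> where "\<phi> = (\<lambda>n. char M (t / (sqrt (real n) * b n)))"
  have "(\<lambda>n. (cmod (\<phi> n ^ n))\<^sup>2) \<longlonglongrightarrow> (cmod (complex_of_real (exp (- t\<^sup>2 / 2))))\<^sup>2"
    unfolding \<phi>_def by (intro tendsto_intros lim)
  moreover have "(cmod (complex_of_real (exp (- t\<^sup>2 / 2))))\<^sup>2 = exp (- t\<^sup>2)"
    by (simp add: exp_double[symmetric])
  moreover have "(cmod (\<phi> n ^ n))\<^sup>2 = ((cmod (\<phi> n))\<^sup>2) ^ n" for n
    by (simp add: norm_power power_mult[symmetric] mult.commute)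
  ultimately have "(\<lambda>n. ((cmod (\<phi> n))\<^sup>2) ^ n) \<longlonglongrightarrow> exp (- t\<^sup>2)"
    by simp
  then have lim1: "(\<lambda>n. real n * (1 - (cmod (\<phi> n))\<^sup>2)) \<longlonglongrightarrow> t\<^sup>2"
    by (intro nth_power_tendsto_imp_rate) (auto simp: \<phi>_def cmod_char_le_1 power_le_one)
  have "(\<lambda>n. sqrt (real n) * Im (\<phi> n)) \<longlonglongrightarrow> 0"
    unfolding \<phi>_def by (rule Im_char_centred[OF int mean b])
  then have "(\<lambda>n. (sqrt (real n) * Im (\<phi> n))\<^sup>2) \<longlonglongrightarrow> 0\<^sup>2"
    by (rule tendsto_power)
  then have lim2: "(\<lambda>n. real n * (1 - (cmod (\<phi> n))\<^sup>2) + (sqrt (real n) * Im (\<phi> n))\<^sup>2) \<longlonglongrightarrow> t\<^sup>2"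
    using tendsto_add[OF lim1] by fastforce
  have "\<phi> \<longlonglongrightarrow> char M 0"
    unfolding \<phi>_def
    by (rule isCont_tendsto_compose[OF isCont_char tendsto_inverse_norming[OF b]])
  then have "(\<lambda>n. 1 + Re (\<phi> n)) \<longlonglongrightarrow> 1 + Re (char M 0)"
    by (intro tendsto_intros)
  then have lim3: "(\<lambda>n. 1 + Re (\<phi> n)) \<longlonglongrightarrow> 2"
    by (simp add: char_zero)
  have lim4: "(\<lambda>n. (real n * (1 - (cmod (\<phi> n))\<^sup>2) + (sqrt (real n) * Im (\<phi> n))\<^sup>2) / (1 + Re (\<phi> n)))
      \<longlonglongrightarrow> t\<^sup>2 / 2"
    by (intro tendsto_divide lim2 lim3) simp
  have pos: "eventually (\<lambda>n. 1 + Re (\<phi> n) > 0) sequentially"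
    using order_tendstoD(1)[OF lim3, of 0] by simp
  have "(\<lambda>n. real n * (1 - Re (\<phi> n))) \<longlonglongrightarrow> t\<^sup>2 / 2"
  proof (rule Lim_transform_eventually[OF lim4 eventually_mono[OF pos]])
    fix n assume elim: "0 < 1 + Re (\<phi> n)"
    have "real n * (1 - (cmod (\<phi> n))\<^sup>2) + (sqrt (real n) * Im (\<phi> n))\<^sup>2
        = real n * (1 - Re (\<phi> n)) * (1 + Re (\<phi> n))"
      unfolding cmod_power2 power_mult_distrib by (simp add: algebra_simps power2_eq_square)
    then show "(real n * (1 - (cmod (\<phi> n))\<^sup>2) + (sqrt (real n) * Im (\<phi> n))\<^sup>2) / (1 + Re (\<phi> n))
        = real n * (1 - Re (\<phi> n))"
      using elim by simp
  qed
  then show ?thesis by (simp add: \<phi>_def)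
qed

text \<open>
  By Baire's theorem the functions \<open>n (1 - Re \<phi>(t / B\<^sub>n))\<close> are uniformly bounded on some interval;
  the trigonometric inequalities above move the bound to a neighbourhood of \<open>0\<close> and then to all \<open>t\<close>.
\<close>

lemma (in real_distribution) Re_char_quadratic_bound:
  fixes B :: "nat \<Rightarrow> real"
  assumes conv: "\<And>t. convergent (\<lambda>n. real n * (1 - Re (char M (t / B n))))"
  shows "\<exists>C. \<forall>n t. real n * (1 - Re (char M (t / B n))) \<le> C * (1 + t\<^sup>2)"
proof -
  define f where "f = (\<lambda>n t. real n * (1 - Re (char M (t / B n))))"
  have f_eq: "f n t = (\<integral>x. real n * (1 - cos (t * (x / B n))) \<partial>M)" for n t
    by (simp add: f_def one_minus_Re_char)
  have f_int: "integrable M (\<lambda>x. 1 - cos (t * (x / B n)))" for n t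
    using integrable_cos[of "t / B n"] by simp
  have cont: "continuous_on UNIV (f n)" for n
  proof -
    have "isCont (\<lambda>t. char M (t / B n)) t" for t
      using isCont_o2[where f="\<lambda>t. t / B n" and g="char M", OF _ isCont_char, of t]
      by (simp add: divide_inverse)
    then show ?thesis
      unfolding f_def by (intro continuous_at_imp_continuous_on ballI continuous_intros)
  qed
  have "\<exists>C. \<forall>n. f n t \<le> C" for t
  proof -
    have "Bseq (\<lambda>n. f n t)" using conv unfolding f_def by (rule convergent_imp_Bseq)
    then obtain K where "\<And>n. \<bar>f n t\<bar> \<le> K" unfolding Bseq_def by auto
    then show ?thesis by (meson abs_le_D1)
  qed
  from pointwise_bounded_imp_bounded_interval[of f, OF cont this]
  obtain a d C where d: "d > 0" and C: "\<And>n t. t \<in> ball a d \<Longrightarrow> f n t \<le> C" by blast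
  have diff: "f n (t - u) \<le> 2 * f n t + 2 * f n u" for n t u
  proof -
    have "f n (t - u) \<le> (\<integral>x. 2 * (real n * (1 - cos (t * (x / B n)))) + 2 * (real n * (1 - cos (u * (x / B n)))) \<partial>M)"
      unfolding f_eq
    proof (intro integral_mono Bochner_Integration.integrable_add integrable_mult_right f_int)
      fix x
      show "real n * (1 - cos ((t - u) * (x / B n))) \<le>
        2 * (real n * (1 - cos (t * (x / B n)))) + 2 * (real n * (1 - cos (u * (x / B n))))"
        using mult_left_mono[OF one_minus_cos_add_le[of "t * (x / B n)" "u * (x / B n)"], of "real n"]
        by (simp add: algebra_simps del: times_divide_eq_right)
    qed
    also have "\<dots> = 2 * f n t + 2 * f n u"
      unfolding f_eq
      by (subst Bochner_Integration.integral_add) ((intro integrable_mult_right f_int)+, simp_all only: integral_mult_right_zero)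
    finally show ?thesis .
  qed
  have mult: "f n (real k * t) \<le> (real k)\<^sup>2 * f n t" for n k t
  proof -
    have "f n (real k * t) \<le> (\<integral>x. (real k)\<^sup>2 * (real n * (1 - cos (t * (x / B n)))) \<partial>M)"
      unfolding f_eq
    proof (intro integral_mono integrable_mult_right f_int)
      fix x
      show "real n * (1 - cos (real k * t * (x / B n))) \<le>
        (real k)\<^sup>2 * (real n * (1 - cos (t * (x / B n))))"
        using mult_left_mono[OF one_minus_cos_mult_le[of k "t * (x / B n)"], of "real n"]
        by (simp add: mult_ac)
    qed
    also have "\<dots> = (real k)\<^sup>2 * f n t"
      unfolding f_eq by simp
    finally show ?thesis .
  qed
  have f_nonneg: "0 \<le> f n t" for n t
    unfolding f_eq by (intro Bochner_Integration.integral_nonneg) auto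
  have small: "f n t \<le> 4 * C" if "\<bar>t\<bar> < d" for n t
  proof -
    \<comment> \<open>Both \<open>a + t\<close> and \<open>a\<close> lie in the ball where the bound
      \<open>C\<close> is known.\<close>
    have "f n ((a + t) - a) \<le> 2 * f n (a + t) + 2 * f n a" by (rule diff)
    also have "\<dots> \<le> 2 * C + 2 * C"
      using d that by (intro add_mono mult_left_mono C) (auto simp: dist_real_def)
    finally show ?thesis by simp
  qed
  have C0: "C \<ge> 0" using small[of 0 0] f_nonneg[of 0 0] d by auto
  have "f n t \<le> (4 * C * (2 / d\<^sup>2 + 8)) * (1 + t\<^sup>2)" for n t
  proof -
    \<comment> \<open>Dividing \<open>t\<close> by \<open>N\<close> lands strictly inside the
      interval of radius \<open>d\<close>; the \<open>+ 1\<close> gives strictness and keeps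
      \<open>N\<close> positive at \<open>t = 0\<close>.\<close>
    define N where "N = nat \<lceil>\<bar>t\<bar> / d\<rceil> + 1"
    have N: "real N > \<bar>t\<bar> / d" "real N \<le> \<bar>t\<bar> / d + 2" "N > 0"
      using d unfolding N_def by (auto; linarith)+
    have "\<bar>t / real N\<bar> < d" using N d by (simp add: field_simps)
    have "f n t = f n (real N * (t / real N))" using N by simp
    also have "\<dots> \<le> (real N)\<^sup>2 * f n (t / real N)" by (rule mult)
    also have "\<dots> \<le> (\<bar>t\<bar> / d + 2)\<^sup>2 * (4 * C)"
      using N f_nonneg by (intro mult_mono small \<open>\<bar>t / real N\<bar> < d\<close> power_mono) auto
    also have "\<dots> \<le> (2 * (t\<^sup>2 / d\<^sup>2) + 8) * (4 * C)"
    proof (rule mult_right_mono)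
      show "(\<bar>t\<bar> / d + 2)\<^sup>2 \<le> 2 * (t\<^sup>2 / d\<^sup>2) + 8"
        using sum_squares_bound[of "\<bar>t\<bar> / d" 2] by (simp add: power2_sum power_divide)
    qed (use C0 in simp)
    also have "\<dots> \<le> ((2 / d\<^sup>2 + 8) * (1 + t\<^sup>2)) * (4 * C)"
    proof (rule mult_right_mono)
      have "(2 / d\<^sup>2 + 8) * (1 + t\<^sup>2) = 2 * (t\<^sup>2 / d\<^sup>2) + 8 + (2 / d\<^sup>2 + 8 * t\<^sup>2)"
        by (simp add: algebra_simps add_divide_distrib)
      then show "2 * (t\<^sup>2 / d\<^sup>2) + 8 \<le> (2 / d\<^sup>2 + 8) * (1 + t\<^sup>2)"
        by simp
    qed (use C0 in simp)
    finally show ?thesis by (simp only: mult_ac)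
  qed
  then show ?thesis unfolding f_def by blast
qed

text \<open>
  The Laplace transform of \<open>x\<^sup>2\<close> is a Gaussian mixture of characteristic functions:
  \<open>exp (- s x\<^sup>2) = E cos (sqrt (2 s) x G)\<close> with \<open>G\<close> standard normal.
\<close>

lemma (in real_distribution) Laplace_square_rate:
  assumes s: "s \<ge> 0"
    and lim: "\<And>t. (\<lambda>n. real n * (1 - Re (char M (t / B n)))) \<longlonglongrightarrow> t\<^sup>2 / 2"
  shows "(\<lambda>n. real n * (1 - (\<integral>x. exp (- s * (x / B n)\<^sup>2) \<partial>M))) \<longlonglongrightarrow> s"
proof -
  interpret G: real_distribution std_normal_distribution by (rule real_dist_normal_dist)
  interpret P: pair_prob_space M std_normal_distribution ..
  define f where "f = (\<lambda>n t. real n * (1 - Re (char M (t / B n))))"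
  define r where "r = sqrt (2 * s)"
  have r2: "r\<^sup>2 = 2 * s" using s by (simp add: r_def)
  have g2: "integrable std_normal_distribution (\<lambda>g. g\<^sup>2)"
    by (rule integrable_std_normal_distribution_moment)
  have Eg2: "(\<integral>g. g\<^sup>2 \<partial>std_normal_distribution) = 1"
    using std_normal_distribution_even_moments[of 1] by simp
  obtain C where C: "\<And>n t. f n t \<le> C * (1 + t\<^sup>2)"
    using Re_char_quadratic_bound[of B] lim convergentI unfolding f_def by blast
  have f_nonneg: "0 \<le> f n t" for n t
    unfolding f_def one_minus_Re_char by (intro mult_nonneg_nonneg Bochner_Integration.integral_nonneg) auto
  have "(\<lambda>n. \<integral>g. f n (r * g) \<partial>std_normal_distribution)
      \<longlonglongrightarrow> (\<integral>g. (r * g)\<^sup>2 / 2 \<partial>std_normal_distribution)"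
  \<comment> \<open>The quadratic bound is uniform in \<open>n\<close> and the Gaussian law has a
    second moment, which permits the exchange of limit and integral.\<close>
  proof (rule integral_dominated_convergence[where w="\<lambda>g. C * (1 + (r * g)\<^sup>2)"])
    show "integrable std_normal_distribution (\<lambda>g. C * (1 + (r * g)\<^sup>2))"
      using g2 by (simp add: power_mult_distrib)
    show "AE g in std_normal_distribution. (\<lambda>n. f n (r * g)) \<longlonglongrightarrow> (r * g)\<^sup>2 / 2"
      unfolding f_def by (intro AE_I2 lim)
    show "AE g in std_normal_distribution. norm (f n (r * g)) \<le> C * (1 + (r * g)\<^sup>2)" for n
      using C f_nonneg by simp
  qed (auto simp: f_def)
  moreover have "(\<integral>g. (r * g)\<^sup>2 / 2 \<partial>std_normal_distribution) = s"
    using Eg2 by (simp add: power_mult_distrib r2)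
  moreover have "(\<integral>g. f n (r * g) \<partial>std_normal_distribution)
      = real n * (1 - (\<integral>x. exp (- s * (x / B n)\<^sup>2) \<partial>M))" for n
  proof -
    have "(\<integral>g. f n (r * g) \<partial>std_normal_distribution)
      = (\<integral>g. (\<integral>x. real n * (1 - cos (r * g / B n * x)) \<partial>M) \<partial>std_normal_distribution)"
      by (simp add: f_def one_minus_Re_char)
    also have "\<dots> = (\<integral>x. (\<integral>g. real n * (1 - cos (r * g / B n * x)) \<partial>std_normal_distribution) \<partial>M)"
    proof (rule P.Fubini_integral)
      show "integrable (M \<Otimes>\<^sub>M std_normal_distribution) (\<lambda>(x, g). real n * (1 - cos (r * g / B n * x)))"
      proof (rule P.integrable_const_bound[where B="real n * 2"])
        have "\<bar>1 - cos u\<bar> \<le> 2" for u :: real using cos_ge_minus_one[of u] cos_le_one[of u] by linarith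
        then show "AE z in M \<Otimes>\<^sub>M std_normal_distribution.
            norm (case z of (x, g) \<Rightarrow> real n * (1 - cos (r * g / B n * x))) \<le> real n * 2"
          by (intro AE_I2) (auto simp: abs_mult intro!: mult_left_mono)
      qed measurable
    qed
    also have "\<dots> = (\<integral>x. real n * (1 - exp (- s * (x / B n)\<^sup>2)) \<partial>M)"
    proof (rule Bochner_Integration.integral_cong[OF refl])
      fix x
      have "(\<integral>g. real n * (1 - cos (r * g / B n * x)) \<partial>std_normal_distribution)
          = real n * (1 - Re (char std_normal_distribution (r / B n * x)))"
        by (simp add: G.one_minus_Re_char mult_ac)
      also have "Re (char std_normal_distribution (r / B n * x)) = exp (- s * (x / B n)\<^sup>2)"
        by (simp add: char_std_normal_distribution power_mult_distrib power_divide r2)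
      finally show "(\<integral>g. real n * (1 - cos (r * g / B n * x)) \<partial>std_normal_distribution)
          = real n * (1 - exp (- s * (x / B n)\<^sup>2))" .
    qed
    also have "\<dots> = real n * (1 - (\<integral>x. exp (- s * (x / B n)\<^sup>2) \<partial>M))"
    proof -
      have "integrable M (\<lambda>x. exp (- s * (x / B n)\<^sup>2))"
        using s by (intro integrable_const_bound[where B=1]) auto
      then show ?thesis using prob_space by simp
    qed
    finally show ?thesis .
  qed
  ultimately show ?thesis by simp
qed

section \<open>Laplace transforms of normed sums of squares\<close>

context prob_space
begin

text \<open>The squares may have infinite mean, so the law of large numbers is not at hand. Levy
  continuity turns the limit law of the sums into a rate for \<open>Re \<phi>\<close>, the Gaussian
  mixture turns this into a rate for Laplace transforms, and independence makes the transform of the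
  normed sum of squares an nth power.\<close>

theorem Raikov:
  fixes Y :: "nat \<Rightarrow> 'a \<Rightarrow> real"
  assumes indep: "indep_vars (\<lambda>_. borel) Y {1..}"
    and ident: "\<And>i. i \<ge> 1 \<Longrightarrow> distr M borel (Y i) = N"
    and int: "integrable M (Y 1)" and mean: "expectation (Y 1) = 0"
    and b: "c > 0" "\<And>n. b n \<ge> c"
    and clt: "weak_conv_m (\<lambda>n. distr M borel (\<lambda>\<omega>. (\<Sum>i=1..n. Y i \<omega>) / (sqrt (real n) * b n)))
      std_normal_distribution"
  shows "conv_in_prob M (\<lambda>n \<omega>. (\<Sum>i=1..n. (Y i \<omega>)\<^sup>2) / (real n * (b n)\<^sup>2)) 1"
proof -
  have Y[measurable]: "random_variable borel (Y i)" if "i \<ge> 1" for i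
    using indep that by (auto simp: indep_vars_def)
  interpret N: real_distribution N
    using ident[of 1] Y[of 1] by (metis order_refl real_distribution_distr)
  define B where "B = (\<lambda>n. sqrt (real n) * b n)"
  have S[measurable]: "random_variable borel (\<lambda>\<omega>. \<Sum>i=1..n. Y i \<omega>)" for n
    by (rule borel_measurable_sum) simp
  have char_S: "char (distr M borel (\<lambda>\<omega>. (\<Sum>i=1..n. Y i \<omega>) / B n)) t = char N (t / B n) ^ n" for n t
  proof -
    have "char (distr M borel (\<lambda>\<omega>. (\<Sum>i=1..n. Y i \<omega>) / B n)) t
        = char (distr M borel (\<lambda>\<omega>. \<Sum>i=1..n. Y i \<omega>)) (t / B n)"
      unfolding char_def by (subst (1 2) integral_distr) (auto simp: mult_ac)
    also have "\<dots> = (\<Prod>i=1..n. char (distr M borel (Y i)) (t / B n))"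
      by (rule char_distr_sum) (auto intro: indep_vars_subset[OF indep])
    also have "\<dots> = (\<Prod>i=1..n. char N (t / B n))"
      by (intro prod.cong) (auto simp: ident)
    finally show ?thesis by simp
  qed
  have Nint: "integrable N (\<lambda>x. x)" "(\<integral>x. x \<partial>N) = 0"
    using int mean Y[of 1] unfolding ident[of 1, symmetric, simplified]
    by (simp_all add: integrable_distr_eq integral_distr)
  have "(\<lambda>n. real n * (1 - Re (char N (t / B n)))) \<longlonglongrightarrow> t\<^sup>2 / 2" for t
    unfolding B_def
  proof (rule N.Re_char_rate[OF Nint b])
    have "(\<lambda>n. char (distr M borel (\<lambda>\<omega>. (\<Sum>i=1..n. Y i \<omega>) / B n)) t)
        \<longlonglongrightarrow> char std_normal_distribution t"
    proof (rule levy_continuity1[OF _ real_dist_normal_dist])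
      show "weak_conv_m (\<lambda>n. distr M borel (\<lambda>\<omega>. (\<Sum>i=1..n. Y i \<omega>) / B n)) std_normal_distribution"
        using clt by (simp add: B_def)
    qed (intro real_distribution_distr borel_measurable_divide S borel_measurable_const)
    then show "(\<lambda>n. char N (t / (sqrt (real n) * b n)) ^ n) \<longlonglongrightarrow> complex_of_real (exp (- t\<^sup>2 / 2))"
      unfolding char_S by (simp add: B_def char_std_normal_distribution)
  qed
  then have rate: "(\<lambda>n. (\<integral>x. exp (- s * (x / B n)\<^sup>2) \<partial>N) ^ n) \<longlonglongrightarrow> exp (- s)" if "s \<ge> 0" for s
    by (intro rate_imp_nth_power_tendsto N.Laplace_square_rate that)
  define W where "W = (\<lambda>n \<omega>. (\<Sum>i=1..n. (Y i \<omega>)\<^sup>2) / (real n * (b n)\<^sup>2))"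
  have W[measurable]: "random_variable borel (W n)" for n
    unfolding W_def by (intro borel_measurable_divide borel_measurable_sum borel_measurable_power Y) auto
  have W_nonneg: "W n \<omega> \<ge> 0" for n \<omega>
    unfolding W_def by (auto intro!: sum_nonneg divide_nonneg_nonneg)
  have Laplace: "expectation (\<lambda>\<omega>. exp (- s * W n \<omega>)) = (\<integral>x. exp (- s * (x / B n)\<^sup>2) \<partial>N) ^ n"
    if "s \<ge> 0" for s n
  proof -
    have "exp (- s * W n \<omega>) = (\<Prod>i=1..n. exp (- s * (Y i \<omega> / B n)\<^sup>2))" for \<omega>
      by (simp add: exp_sum[symmetric] W_def B_def sum_divide_distrib power_divide
          power_mult_distrib sum_distrib_left sum_negf)
    then have "expectation (\<lambda>\<omega>. exp (- s * W n \<omega>)) = expectation (\<lambda>\<omega>. \<Prod>i=1..n. exp (- s * (Y i \<omega> / B n)\<^sup>2))"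
      by simp
    also have "\<dots> = (\<Prod>i=1..n. expectation (\<lambda>\<omega>. exp (- s * (Y i \<omega> / B n)\<^sup>2)))"
    proof (rule indep_vars_lebesgue_integral)
      show "indep_vars (\<lambda>_. borel) (\<lambda>i \<omega>. exp (- s * (Y i \<omega> / B n)\<^sup>2)) {1..n}"
        by (rule indep_vars_compose2[OF indep_vars_subset[OF indep], where Y="\<lambda>i x. exp (- s * (x / B n)\<^sup>2)"]) auto
      show "integrable M (\<lambda>\<omega>. exp (- s * (Y i \<omega> / B n)\<^sup>2))" if "i \<in> {1..n}" for i
        using that \<open>s \<ge> 0\<close> Y[of i] by (intro integrable_const_bound[where B=1]) auto
    qed simp
    also have "\<dots> = (\<Prod>i=1..n. \<integral>x. exp (- s * (x / B n)\<^sup>2) \<partial>N)"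
    proof (rule prod.cong[OF refl])
      fix i assume "i \<in> {1..n}"
      then have "i \<ge> 1" by simp
      then show "expectation (\<lambda>\<omega>. exp (- s * (Y i \<omega> / B n)\<^sup>2)) = (\<integral>x. exp (- s * (x / B n)\<^sup>2) \<partial>N)"
        using Y[of i] by (simp add: ident[symmetric] integral_distr)
    qed
    finally show ?thesis by simp
  qed
  have Eint: "integrable M (\<lambda>\<omega>. exp (- s * W n \<omega>))" if "s \<ge> 0" for s n
    using W_nonneg that by (intro integrable_const_bound[where B=1]) auto
  have Elim: "(\<lambda>n. expectation (\<lambda>\<omega>. exp (- s * W n \<omega>))) \<longlonglongrightarrow> exp (- s)" if "s \<ge> 0" for s
    using rate[OF that] Laplace[OF that] by simp
  define e where "e = exp (- 1 :: real)"
  \<comment> \<open>Convergence of the Laplace transforms at 1 and 2 already gives \<open>exp (- W n) \<rightarrow> exp (- 1)\<close> in \<open>L\<^sup>2\<close>.\<close>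
  have var: "\<bar>(exp (- W n \<omega>) - e)\<^sup>2\<bar> = exp (- 2 * W n \<omega>) - 2 * e * exp (- 1 * W n \<omega>) + e\<^sup>2" for n \<omega>
    by (subst abs_power2) (simp add: power2_diff exp_double[symmetric])
  have "conv_in_prob M (\<lambda>n \<omega>. (exp (- W n \<omega>) - e)\<^sup>2) 0"
  proof (rule conv_in_prob_L1)
    have "(\<lambda>n. expectation (\<lambda>\<omega>. exp (- 2 * W n \<omega>)) - 2 * e * expectation (\<lambda>\<omega>. exp (- 1 * W n \<omega>)) + e\<^sup>2)
      \<longlonglongrightarrow> exp (- 2) - 2 * e * exp (- 1) + e\<^sup>2"
      by (intro tendsto_intros Elim) auto
    moreover have "exp (- 2) - 2 * e * exp (- 1) + e\<^sup>2 = 0"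
      by (simp add: e_def power2_eq_square exp_add[symmetric])
    moreover have "expectation (\<lambda>\<omega>. \<bar>(exp (- W n \<omega>) - e)\<^sup>2\<bar>) = expectation (\<lambda>\<omega>. exp (- 2 * W n \<omega>)) -
        2 * e * expectation (\<lambda>\<omega>. exp (- 1 * W n \<omega>)) + e\<^sup>2" for n
      unfolding var using Eint[of 1 n] Eint[of 2 n] prob_space by simp
    ultimately show "(\<lambda>n. expectation (\<lambda>\<omega>. \<bar>(exp (- W n \<omega>) - e)\<^sup>2\<bar>)) \<longlonglongrightarrow> 0"
      by simp
    show "\<forall>\<^sub>F n in sequentially. integrable M (\<lambda>\<omega>. (exp (- W n \<omega>) - e)\<^sup>2)"
      using var Eint[of 1] Eint[of 2] by (intro always_eventually allI) (simp add: abs_if)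
  qed simp
  from conv_in_prob_cont[OF this, of sqrt, OF isCont_real_sqrt]
  have "conv_in_prob M (\<lambda>n \<omega>. \<bar>exp (- W n \<omega>) - e\<bar>) 0" by simp
  then have "conv_in_prob M (\<lambda>n \<omega>. exp (- W n \<omega>)) e"
    by (rule conv_in_prob_dominated[rotated]) auto
  \<comment> \<open>The limit \<open>e\<close> is positive, so the logarithm is continuous there and
    recovers \<open>W n\<close> from its exponential.\<close>
  moreover have "isCont (\<lambda>x. - ln x) e"
    by (intro continuous_intros) (simp_all add: e_def)
  ultimately have "conv_in_prob M (\<lambda>n \<omega>. - ln (exp (- W n \<omega>))) (- ln e)"
    by (rule conv_in_prob_cont) measurable
  then show ?thesis by (simp add: e_def W_def)
qed

end

section \<open>U-statistics and their jackknife\<close>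

lemma increasing_tuplesD:
  assumes "j \<in> increasing_tuples m S"
  shows "inj_on j {1..m}" "j ` {1..m} \<subseteq> S" "card (j ` {1..m}) = m" "j \<in> extensional {1..m}"
  using assms strict_mono_on_imp_inj_on[of "{1..m}" j]
  by (auto simp: increasing_tuples_def card_image PiE_def)

text \<open>A finite set has only one increasing listing, so an increasing tuple is determined by
  its image.\<close>

lemma increasing_tuple_map_eq:
  assumes "j \<in> increasing_tuples m S"
  shows "map j [1..<Suc m] = sorted_list_of_set (j ` {1..m})"
proof (rule strict_sorted_equal)
  show "sorted_wrt (<) (map j [1..<Suc m])"
    unfolding sorted_wrt_map
  proof (rule sorted_wrt_mono_rel[OF _ sorted_wrt_upt])
    show "j x < j y" if "x \<in> set [1..<Suc m]" "y \<in> set [1..<Suc m]" "x < y" for x y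
      using assms that by (auto simp: increasing_tuples_def strict_mono_on_def)
  qed
qed auto

text \<open>Replaces tuples by \<open>m\<close>-subsets, so that the index sets of the statistics
  can be counted by binomial coefficients.\<close>

lemma bij_betw_increasing_tuples:
  assumes "finite S"
  shows "bij_betw (\<lambda>j. j ` {1..m}) (increasing_tuples m S) {A. A \<subseteq> S \<and> card A = m}"
proof (rule bij_betw_imageI)
  show "inj_on (\<lambda>j. j ` {1..m}) (increasing_tuples m S)"
  proof (rule inj_onI)
    fix j j' assume j: "j \<in> increasing_tuples m S" "j' \<in> increasing_tuples m S"
      and "j ` {1..m} = j' ` {1..m}"
    then have "map j [1..<Suc m] = map j' [1..<Suc m]"
      by (simp only: increasing_tuple_map_eq)
    then have "j k = j' k" if "k \<in> {1..m}" for k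
      using that unfolding map_eq_conv by (metis atLeastLessThanSuc_atLeastAtMost atLeastLessThan_upt)
    then show "j = j'"
      using j by (intro extensionalityI[of j "{1..m}" j']) (auto dest: increasing_tuplesD)
  qed
  show "(\<lambda>j. j ` {1..m}) ` increasing_tuples m S = {A. A \<subseteq> S \<and> card A = m}"
  proof (intro equalityI subsetI)
    fix A assume "A \<in> {A. A \<subseteq> S \<and> card A = m}"
    then have A: "A \<subseteq> S" "card A = m" "finite A" using assms finite_subset by auto
    define xs where "xs = sorted_list_of_set A"
    have xs: "length xs = m" "set xs = A" "sorted_wrt (<) xs"
      using A by (auto simp: xs_def)
    \<comment> \<open>Positions start at 1 and list indices at 0, hence the shift.\<close>
    define j where "j = (\<lambda>k\<in>{1..m}. xs ! (k - 1))"
    have "j ` {1..m} = (\<lambda>k. xs ! k) ` {..<m}"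
    proof -
      have "{1..m} = Suc ` {..<m}" by (auto simp: image_Suc_lessThan)
      then show ?thesis by (auto simp: j_def image_image)
    qed
    also have "\<dots> = A" using xs by (auto simp: set_conv_nth)
    finally have jA: "j ` {1..m} = A" .
    moreover have "j \<in> increasing_tuples m S"
      using jA A(1) xs
      by (auto simp: increasing_tuples_def strict_mono_on_def j_def sorted_wrt_iff_nth_less)
    ultimately show "A \<in> (\<lambda>j. j ` {1..m}) ` increasing_tuples m S" by blast
  next
    fix A assume "A \<in> (\<lambda>j. j ` {1..m}) ` increasing_tuples m S"
    then obtain j where "j \<in> increasing_tuples m S" "A = j ` {1..m}" by blast
    then show "A \<in> {A. A \<subseteq> S \<and> card A = m}"
      using increasing_tuplesD[of j m S] by simp
  qed
qed

lemma finite_increasing_tuples: "finite S \<Longrightarrow> finite (increasing_tuples m S)"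
  using bij_betw_finite[OF bij_betw_increasing_tuples] by simp

text \<open>Removing \<open>T\<close> from such a subset leaves an arbitrary subset of
  \<open>S - T\<close> of the complementary size. Only one-point and two-point sets \<open>T\<close>
  are used later.\<close>

lemma card_increasing_tuples_containing:
  assumes S: "finite S" and T: "T \<subseteq> S" "card T \<le> m"
  shows "card {j \<in> increasing_tuples m S. T \<subseteq> j ` {1..m}} = (card S - card T) choose (m - card T)"
proof -
  have finT: "finite T" using S T finite_subset by blast
  have "bij_betw (\<lambda>j. j ` {1..m}) {j \<in> increasing_tuples m S. T \<subseteq> j ` {1..m}}
      {A. A \<subseteq> S \<and> card A = m \<and> T \<subseteq> A}"
  proof (rule bij_betw_subset[OF bij_betw_increasing_tuples[OF S]])
    have "(\<lambda>j. j ` {1..m}) ` {j \<in> increasing_tuples m S. T \<subseteq> j ` {1..m}}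
        = {A \<in> (\<lambda>j. j ` {1..m}) ` increasing_tuples m S. T \<subseteq> A}"
      by blast
    then show "(\<lambda>j. j ` {1..m}) ` {j \<in> increasing_tuples m S. T \<subseteq> j ` {1..m}}
        = {A. A \<subseteq> S \<and> card A = m \<and> T \<subseteq> A}"
      unfolding bij_betw_imp_surj_on[OF bij_betw_increasing_tuples[OF S]] by (simp only: mem_Collect_eq conj_assoc)
  qed blast
  then have "card {j \<in> increasing_tuples m S. T \<subseteq> j ` {1..m}} = card {A. A \<subseteq> S \<and> card A = m \<and> T \<subseteq> A}"
    by (rule bij_betw_same_card)
  also have "\<dots> = card {A. A \<subseteq> S - T \<and> card A = m - card T}"
  proof (rule bij_betw_same_card)
    show "bij_betw (\<lambda>A. A - T) {A. A \<subseteq> S \<and> card A = m \<and> T \<subseteq> A} {A. A \<subseteq> S - T \<and> card A = m - card T}"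
    proof (rule bij_betw_byWitness[where f'="\<lambda>A. A \<union> T"])
      show "(\<lambda>A. A \<union> T) ` {A. A \<subseteq> S - T \<and> card A = m - card T} \<subseteq> {A. A \<subseteq> S \<and> card A = m \<and> T \<subseteq> A}"
      proof (rule image_subsetI)
        fix A assume "A \<in> {A. A \<subseteq> S - T \<and> card A = m - card T}"
        then have A: "A \<subseteq> S - T" "card A = m - card T" by auto
        then have "card (A \<union> T) = card A + card T"
          using S finT by (intro card_Un_disjoint) (auto intro: finite_subset[of A "S - T"])
        then show "A \<union> T \<in> {A. A \<subseteq> S \<and> card A = m \<and> T \<subseteq> A}" using A T by auto
      qed
    qed (auto simp: card_Diff_subset[OF finT])
  qed
  also have "\<dots> = (card S - card T) choose (m - card T)"
    using n_subsets[of "S - T" "m - card T"] S T by (simp add: card_Diff_subset[OF finT])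
  finally show ?thesis .
qed

lemma increasing_tuples_Diff_singleton:
  "increasing_tuples m (S - {i}) = {j \<in> increasing_tuples m S. i \<notin> j ` {1..m}}"
  by (auto simp: increasing_tuples_def PiE_iff)

section \<open>Subsets through a given index and the jackknife differences\<close>

definition tuples_at :: "nat \<Rightarrow> nat \<Rightarrow> nat \<Rightarrow> (nat \<Rightarrow> nat) set" where
  "tuples_at m n i = {j \<in> increasing_tuples m {1..n}. i \<in> j ` {1..m}}"

lemma finite_tuples_at [simp]: "finite (tuples_at m n i)"
  by (simp add: tuples_at_def finite_increasing_tuples)

lemma card_tuples_at:
  "m \<ge> 1 \<Longrightarrow> i \<in> {1..n} \<Longrightarrow> card (tuples_at m n i) = (n - 1) choose (m - 1)"
  using card_increasing_tuples_containing[of "{1..n}" "{i}" m] by (simp add: tuples_at_def)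

lemma card_tuples_at_two:
  assumes "m \<ge> 2" "i \<in> {1..n}" "s \<in> {1..n}" "s \<noteq> i"
  shows "card {j \<in> tuples_at m n i. s \<in> j ` {1..m}} = (n - 2) choose (m - 2)"
proof -
  have "{j \<in> tuples_at m n i. s \<in> j ` {1..m}} = {j \<in> increasing_tuples m {1..n}. {i, s} \<subseteq> j ` {1..m}}"
    by (auto simp: tuples_at_def)
  then show ?thesis
    using card_increasing_tuples_containing[of "{1..n}" "{i, s}" m] assms
    by (simp add: numeral_2_eq_2)
qed

text \<open>The \<open>v\<^sub>i\<close> of the outline: for \<open>m \<ge> 1\<close> and a sample
  index \<open>i\<close>, the divisor is the number of summands.\<close>

definition point_avg :: "nat \<Rightarrow> ((nat \<Rightarrow> real) \<Rightarrow> real) \<Rightarrow> (nat \<Rightarrow> real) \<Rightarrow> nat \<Rightarrow> nat \<Rightarrow> real" where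
  "point_avg m h x n i =
     (\<Sum>j\<in>tuples_at m n i. h (\<lambda>k\<in>{1..m}. x (j k))) / real ((n - 1) choose (m - 1))"

text \<open>Let \<open>S\<close> be the sum over all subsets and \<open>T i\<close> the part through
  \<open>i\<close>. Omitting observation \<open>i\<close> leaves \<open>S - T i\<close>, and the
  \<open>T k\<close> add up to \<open>m * S\<close>. All three binomial coefficients are expressed
  by the same \<open>c\<close>; \<open>n > m\<close> keeps the divisors positive.\<close>

lemma U_jack_minus_U_stat:
  assumes "m \<ge> 1" "n > m" "i \<in> {1..n}"
  shows "U_jack m h x n i - U_stat m h x n =
    real m / (real n - real m) * ((\<Sum>k=1..n. point_avg m h x n k) / real n - point_avg m h x n i)"
proof -
  define a where "a = (\<lambda>j :: nat \<Rightarrow> nat. h (\<lambda>k\<in>{1..m}. x (j k)))"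
  define J where "J = increasing_tuples m {1..n}"
  define c where "c = real ((n - 1) choose (m - 1))"
  define S where "S = (\<Sum>j\<in>J. a j)"
  define T where "T = (\<lambda>i. \<Sum>j\<in>tuples_at m n i. a j)"
  have finJ: "finite J" by (simp add: J_def finite_increasing_tuples)
  have c0: "c > 0" using assms by (simp add: c_def zero_less_binomial)
  have n0: "real n > 0" "real m > 0" "real n - real m > 0" using assms by auto
  have T: "T i = c * point_avg m h x n i" for i
    using c0 by (simp add: point_avg_def T_def a_def c_def)
  \<comment> \<open>Double counting: each subset is met once for each of its \<open>m\<close>
    points.\<close>
  have "(\<Sum>k=1..n. T k) = (\<Sum>k=1..n. \<Sum>j\<in>J. if k \<in> j ` {1..m} then a j else 0)"
    unfolding T_def tuples_at_def J_def[symmetric] using finJ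
    by (simp only: sum.inter_filter)
  also have "\<dots> = (\<Sum>j\<in>J. \<Sum>k=1..n. if k \<in> j ` {1..m} then a j else 0)"
    by (rule sum.swap)
  also have "\<dots> = (\<Sum>j\<in>J. real m * a j)"
  proof (rule sum.cong[OF refl])
    fix j assume "j \<in> J"
    then have "{1..n} \<inter> j ` {1..m} = j ` {1..m}" "card (j ` {1..m}) = m"
      using increasing_tuplesD[of j m "{1..n}"] by (auto simp: J_def)
    then show "(\<Sum>k=1..n. if k \<in> j ` {1..m} then a j else 0) = real m * a j"
      by (simp add: sum.If_cases)
  qed
  finally have sumT: "real m * S = c * (\<Sum>k=1..n. point_avg m h x n k)"
    by (simp add: S_def T sum_distrib_left)
  have jack: "(\<Sum>j \<in> increasing_tuples m ({1..n} - {i}). a j) = S - T i"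
  proof -
    have "J = increasing_tuples m ({1..n} - {i}) \<union> tuples_at m n i"
      unfolding increasing_tuples_Diff_singleton by (auto simp: J_def tuples_at_def)
    moreover have "increasing_tuples m ({1..n} - {i}) \<inter> tuples_at m n i = {}"
      unfolding increasing_tuples_Diff_singleton by (auto simp: tuples_at_def)
    ultimately have "S = (\<Sum>j \<in> increasing_tuples m ({1..n} - {i}). a j) + T i"
      unfolding S_def T_def by (simp add: sum.union_disjoint finite_increasing_tuples)
    then show ?thesis by simp
  qed
  have b1: "real ((n - 1) choose m) = c * (real n - real m) / real m"
  proof -
    have "m * ((n - 1) choose m) = (n - m) * ((n - 1) choose (m - 1))"
      using binomial_absorb_comp[of "n - 1" "m - 1"] binomial_absorption[of "m - 1" "n - 1"] assms
      by simp
    then have "real m * real ((n - 1) choose m) = real (n - m) * c"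
      unfolding c_def by (metis of_nat_mult)
    then show ?thesis using assms by (simp add: field_simps of_nat_diff)
  qed
  have b2: "real (n choose m) = c * real n / real m"
  proof -
    have "m * (n choose m) = n * ((n - 1) choose (m - 1))"
      using binomial_absorption[of "m - 1" n] assms by simp
    then have "real m * real (n choose m) = real n * c"
      unfolding c_def by (metis of_nat_mult)
    then show ?thesis using assms by (simp add: field_simps)
  qed
  have "U_jack m h x n i - U_stat m h x n
      = real m / (c * (real n - real m)) * (S - T i) - real m / (c * real n) * S"
    unfolding U_jack_def U_stat_def b1 b2 a_def[symmetric] J_def[symmetric] S_def[symmetric] jack
    using c0 n0 by (simp add: field_simps)
  also have "\<dots> = real m / (real n - real m) * (real m * S / (c * real n) - T i / c)"
    using c0 n0 by (simp add: divide_simps) (simp add: algebra_simps)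
  also have "\<dots> = real m / (real n - real m) * ((\<Sum>k=1..n. point_avg m h x n k) / real n - point_avg m h x n i)"
    unfolding sumT T using c0 n0 by simp
  finally show ?thesis .
qed

section \<open>Conditional means of kernels\<close>

text \<open>Under independence the joint law is a product measure, so Fubini applies. The third
  claim is kept because the inner integral is 0 by convention at non-integrable sections, where
  additivity in the integrand may fail.\<close>

lemma (in prob_space) indep_var_Fubini:
  fixes f :: "'b \<times> 'b \<Rightarrow> real"
  assumes indep: "indep_var S W T V"
    and f[measurable]: "f \<in> borel_measurable (S \<Otimes>\<^sub>M T)"
    and int: "integrable M (\<lambda>\<omega>. f (W \<omega>, V \<omega>))"
  shows "integrable M (\<lambda>\<omega>. \<integral>y. f (W \<omega>, y) \<partial>distr M T V)"
    and "expectation (\<lambda>\<omega>. \<integral>y. f (W \<omega>, y) \<partial>distr M T V) = expectation (\<lambda>\<omega>. f (W \<omega>, V \<omega>))"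
    and "AE \<omega> in M. integrable (distr M T V) (\<lambda>y. f (W \<omega>, y))"
proof -
  have [measurable]: "W \<in> measurable M S" "V \<in> measurable M T"
    and J: "distr M S W \<Otimes>\<^sub>M distr M T V = distr M (S \<Otimes>\<^sub>M T) (\<lambda>\<omega>. (W \<omega>, V \<omega>))"
    using indep unfolding indep_var_distribution_eq by auto
  interpret W: prob_space "distr M S W" by (rule prob_space_distr) simp
  interpret V: prob_space "distr M T V" by (rule prob_space_distr) simp
  interpret P: pair_prob_space "distr M S W" "distr M T V" ..
  have intJ: "integrable (distr M S W \<Otimes>\<^sub>M distr M T V) f"
    unfolding J using int by (subst integrable_distr_eq) auto
  have meas: "(\<lambda>x. \<integral>y. f (x, y) \<partial>distr M T V) \<in> borel_measurable S"
    using P.integrable_fst'[OF intJ] borel_measurable_integrable by fastforce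
  show "integrable M (\<lambda>\<omega>. \<integral>y. f (W \<omega>, y) \<partial>distr M T V)"
    using P.integrable_fst'[OF intJ] meas by (simp add: integrable_distr_eq)
  have "expectation (\<lambda>\<omega>. \<integral>y. f (W \<omega>, y) \<partial>distr M T V) = (\<integral>x. \<integral>y. f (x, y) \<partial>distr M T V \<partial>distr M S W)"
    using meas by (simp add: integral_distr)
  also have "\<dots> = integral\<^sup>L (distr M S W \<Otimes>\<^sub>M distr M T V) f"
    by (rule P.integral_fst'[OF intJ])
  also have "\<dots> = expectation (\<lambda>\<omega>. f (W \<omega>, V \<omega>))"
    unfolding J by (subst integral_distr) auto
  finally show "expectation (\<lambda>\<omega>. \<integral>y. f (W \<omega>, y) \<partial>distr M T V) = expectation (\<lambda>\<omega>. f (W \<omega>, V \<omega>))" .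
  have "AE x in distr M S W. integrable (distr M T V) (\<lambda>y. f (x, y))"
    by (rule P.AE_integrable_fst'[OF intJ])
  then show "AE \<omega> in M. integrable (distr M T V) (\<lambda>y. f (W \<omega>, y))"
    by (rule AE_distrD[rotated]) simp
qed

lemma symmetric_kernel_comp: "symmetric_kernel m h \<Longrightarrow> symmetric_kernel m (\<lambda>x. \<phi> (h x))"
  by (simp add: symmetric_kernel_def)

section \<open>The sample, its tuples and conditional means\<close>

locale iid_sample = prob_space M for M :: "'a measure" +
  fixes X :: "nat \<Rightarrow> 'a \<Rightarrow> real" and F :: "real measure" and m :: nat
  assumes m: "m \<ge> 1" and iid: "iid_seq M X F"
begin

lemma indep_X: "indep_vars (\<lambda>_. borel) X {1..}"
  using iid by (simp add: iid_seq_def)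

lemma distr_X: "i \<ge> 1 \<Longrightarrow> distr M borel (X i) = F"
  using iid by (simp add: iid_seq_def)

lemma measurable_X: "i \<ge> 1 \<Longrightarrow> X i \<in> borel_measurable M"
  using indep_X by (auto simp: indep_vars_def)

lemma real_distribution_F: "real_distribution F"
  using measurable_X[of 1] distr_X[of 1] by (metis order_refl real_distribution_distr)

lemma prob_space_F: "prob_space F"
  using real_distribution_F by (simp add: real_distribution_def)

lemma sets_F [measurable_cong]: "sets F = sets borel"
  using real_distribution_F by (simp add: real_distribution_def real_distribution_axioms_def)

lemma sets_PiM_F [measurable_cong]: "sets (PiM I (\<lambda>_. F)) = sets (PiM I (\<lambda>_. borel))"
  by (intro sets_PiM_cong refl sets_F)

text \<open>The whole sequence has an infinite product law, and selecting distinct coordinates of it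
  gives again a product of copies of \<open>F\<close>. Hence all injective tuples of one length
  share the same law.\<close>

lemma distr_tuple:
  assumes f: "inj_on f I" "f \<in> I \<rightarrow> {1..}"
  shows "distr M (PiM I (\<lambda>_. borel)) (\<lambda>\<omega>. \<lambda>k\<in>I. X (f k) \<omega>) = PiM I (\<lambda>_. F)"
proof -
  have X[measurable]: "(\<lambda>\<omega>. \<lambda>i\<in>{1..}. X i \<omega>) \<in> measurable M (PiM {1..} (\<lambda>_. borel))"
    by (rule measurable_restrict) (simp add: measurable_X)
  have "distr M (PiM {1..} (\<lambda>_. borel)) (\<lambda>\<omega>. \<lambda>i\<in>{1..}. X i \<omega>) = PiM {1..} (\<lambda>i. distr M borel (X i))"
    using indep_X by (subst (asm) indep_vars_iff_distr_eq_PiM') (auto simp: measurable_X)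
  also have "\<dots> = PiM {1..} (\<lambda>_. F)"
    by (intro PiM_cong) (auto simp: distr_X)
  finally have law: "distr M (PiM {1..} (\<lambda>_. borel)) (\<lambda>\<omega>. \<lambda>i\<in>{1..}. X i \<omega>) = PiM {1..} (\<lambda>_. F)" .
  have r[measurable]: "(\<lambda>\<omega>. \<lambda>k\<in>I. \<omega> (f k)) \<in> measurable (PiM {1..} (\<lambda>_. borel)) (PiM I (\<lambda>_. borel))"
    by (rule measurable_restrict, rule measurable_component_singleton) (use f in auto)
  have "PiM I (\<lambda>_. F) = distr (PiM {1..} (\<lambda>_. F)) (PiM I (\<lambda>_. F)) (\<lambda>\<omega>. \<lambda>k\<in>I. \<omega> (f k))"
    by (rule distr_PiM_reindex[symmetric]) (use prob_space_F f in auto)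
  also have "\<dots> = distr (distr M (PiM {1..} (\<lambda>_. borel)) (\<lambda>\<omega>. \<lambda>i\<in>{1..}. X i \<omega>)) (PiM I (\<lambda>_. borel))
      (\<lambda>\<omega>. \<lambda>k\<in>I. \<omega> (f k))"
    unfolding law by (intro distr_cong refl sets_PiM_F)
  also have "\<dots> = distr M (PiM I (\<lambda>_. borel)) (\<lambda>\<omega>. \<lambda>k\<in>I. X (f k) \<omega>)"
    unfolding distr_distr[OF r X]
  proof (intro distr_cong refl)
    fix \<omega>
    show "((\<lambda>\<omega>. \<lambda>k\<in>I. \<omega> (f k)) \<circ> (\<lambda>\<omega>. \<lambda>i\<in>{1..}. X i \<omega>)) \<omega> = (\<lambda>k\<in>I. X (f k) \<omega>)"
      using f(2) by (auto simp: fun_eq_iff restrict_def Pi_iff)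
  qed
  finally show ?thesis by simp
qed

definition tuple :: "(nat \<Rightarrow> nat) \<Rightarrow> 'a \<Rightarrow> nat \<Rightarrow> real" where
  "tuple j \<omega> = (\<lambda>k\<in>{1..m}. X (j k) \<omega>)"

lemma measurable_tuple:
  "j \<in> {1..m} \<rightarrow> {1..} \<Longrightarrow> tuple j \<in> measurable M (PiM {1..m} (\<lambda>_. borel))"
  unfolding tuple_def[abs_def] by (rule measurable_restrict, rule measurable_X) auto

lemma
  fixes k :: "(nat \<Rightarrow> real) \<Rightarrow> real"
  assumes j: "inj_on j {1..m}" "j \<in> {1..m} \<rightarrow> {1..}"
    and k: "k \<in> borel_measurable (PiM {1..m} (\<lambda>_. borel))"
  shows integrable_tuple_iff: "integrable M (\<lambda>\<omega>. k (tuple j \<omega>)) \<longleftrightarrow> integrable M (\<lambda>\<omega>. k (tuple (\<lambda>i. i) \<omega>))"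
    and expectation_tuple: "expectation (\<lambda>\<omega>. k (tuple j \<omega>)) = expectation (\<lambda>\<omega>. k (tuple (\<lambda>i. i) \<omega>))"
proof -
  have *: "integrable M (\<lambda>\<omega>. k (tuple f \<omega>)) \<longleftrightarrow> integrable (PiM {1..m} (\<lambda>_. F)) k"
    "expectation (\<lambda>\<omega>. k (tuple f \<omega>)) = integral\<^sup>L (PiM {1..m} (\<lambda>_. F)) k"
    if "inj_on f {1..m}" "f \<in> {1..m} \<rightarrow> {1..}" for f
    unfolding distr_tuple[OF that, folded tuple_def, symmetric]
    using integrable_distr_eq[OF measurable_tuple[OF that(2)] k]
      integral_distr[OF measurable_tuple[OF that(2)] k] by simp_all
  show "integrable M (\<lambda>\<omega>. k (tuple j \<omega>)) \<longleftrightarrow> integrable M (\<lambda>\<omega>. k (tuple (\<lambda>i. i) \<omega>))"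
    "expectation (\<lambda>\<omega>. k (tuple j \<omega>)) = expectation (\<lambda>\<omega>. k (tuple (\<lambda>i. i) \<omega>))"
    using *[OF j] *[of "\<lambda>i. i"] by auto
qed

text \<open>An explicit, everywhere defined version of the regression of the kernel on its first
  argument, with value 0 where the section is not integrable. For \<open>m = 1\<close> the product
  is over the empty set and nothing is integrated out.\<close>

definition cmean :: "((nat \<Rightarrow> real) \<Rightarrow> real) \<Rightarrow> real \<Rightarrow> real" where
  "cmean k x = (\<integral>y. k (y(1 := x)) \<partial>PiM {2..m} (\<lambda>_. F))"

lemma prob_space_section: "prob_space (PiM {2..m} (\<lambda>_. F))"
  by (intro prob_space_PiM prob_space_F)

lemma measurable_section:
  fixes k :: "(nat \<Rightarrow> real) \<Rightarrow> real"
  assumes [measurable]: "k \<in> borel_measurable (PiM {1..m} (\<lambda>_. borel))"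
  shows "(\<lambda>(x, y). k (y(1 := x))) \<in> borel_measurable (borel \<Otimes>\<^sub>M PiM {2..m} (\<lambda>_. borel))"
proof -
  have I: "insert 1 {2..m} = {1..m}" using m by auto
  have "(\<lambda>(y, x). y(1 := x)) \<in> measurable (PiM {2..m} (\<lambda>_. borel) \<Otimes>\<^sub>M borel) (PiM {1..m} (\<lambda>_. borel :: real measure))"
    using measurable_add_dim[of "1::nat" "{2..m}" "\<lambda>_. borel :: real measure"] unfolding I .
  from measurable_compose[OF measurable_pair_swap' this]
  have "(\<lambda>(x, y). y(1 := x)) \<in> measurable (borel \<Otimes>\<^sub>M PiM {2..m} (\<lambda>_. borel)) (PiM {1..m} (\<lambda>_. borel :: real measure))"
    by (simp add: case_prod_beta)
  from measurable_compose[OF this assms] show ?thesis by (simp add: case_prod_beta)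
qed

lemma borel_measurable_cmean:
  assumes "k \<in> borel_measurable (PiM {1..m} (\<lambda>_. borel))"
  shows "cmean k \<in> borel_measurable borel"
proof -
  interpret Q: prob_space "PiM {2..m} (\<lambda>_. F)" by (rule prob_space_section)
  have "(\<lambda>(x, y). k (y(1 := x))) \<in> borel_measurable (borel \<Otimes>\<^sub>M PiM {2..m} (\<lambda>_. F))"
    using measurable_section[OF assms] by measurable
  then show ?thesis unfolding cmean_def[abs_def] by (rule Q.borel_measurable_lebesgue_integral)
qed

text \<open>The arguments of the kernel other than the one at \<open>j 1\<close> have indices
  outside \<open>D\<close>, hence are independent of all coordinates in \<open>D\<close>. So
  \<open>cmean k (X (j 1))\<close> acts as the conditional expectation of the kernel given these
  coordinates, tested against \<open>w\<close>.\<close>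

lemma
  fixes k :: "(nat \<Rightarrow> real) \<Rightarrow> real"
  assumes j: "inj_on j {1..m}" "j \<in> {1..m} \<rightarrow> {1..}"
    and D: "D \<subseteq> {1..}" "j 1 \<in> D" "D \<inter> j ` {2..m} = {}"
    and k: "k \<in> borel_measurable (PiM {1..m} (\<lambda>_. borel))"
    and w: "w \<in> borel_measurable (PiM D (\<lambda>_. borel))"
    and int: "integrable M (\<lambda>\<omega>. k (tuple j \<omega>) * w (\<lambda>i\<in>D. X i \<omega>))"
  shows integrable_cmean_mult: "integrable M (\<lambda>\<omega>. cmean k (X (j 1) \<omega>) * w (\<lambda>i\<in>D. X i \<omega>))"
    and expectation_cmean_mult: "expectation (\<lambda>\<omega>. cmean k (X (j 1) \<omega>) * w (\<lambda>i\<in>D. X i \<omega>))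
      = expectation (\<lambda>\<omega>. k (tuple j \<omega>) * w (\<lambda>i\<in>D. X i \<omega>))"
    and AE_integrable_section_mult: "AE \<omega> in M. integrable (PiM {2..m} (\<lambda>_. F))
      (\<lambda>y. k (y(1 := X (j 1) \<omega>)) * w (\<lambda>i\<in>D. X i \<omega>))"
proof -
  let ?W = "\<lambda>\<omega>. \<lambda>i\<in>D. X i \<omega>" and ?V = "\<lambda>\<omega>. \<lambda>i\<in>{2..m}. X (j i) \<omega>"
  let ?f = "\<lambda>(z, y). k (y(1 := z (j 1))) * w z"
  have indep: "indep_var (PiM D (\<lambda>_. borel)) ?W (PiM {2..m} (\<lambda>_. borel)) ?V"
  proof -
    have "indep_var (PiM D (\<lambda>_. borel)) (id \<circ> ?W) (PiM {2..m} (\<lambda>_. borel))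
        ((\<lambda>z. \<lambda>i\<in>{2..m}. z (j i)) \<circ> (\<lambda>\<omega>. \<lambda>i\<in>j ` {2..m}. X i \<omega>))"
    proof (rule indep_var_compose[OF indep_var_restrict[OF indep_X]])
      show "(\<lambda>z. \<lambda>i\<in>{2..m}. z (j i)) \<in> measurable (PiM (j ` {2..m}) (\<lambda>_. borel)) (PiM {2..m} (\<lambda>_. borel))"
        by (rule measurable_restrict, rule measurable_component_singleton) auto
    qed (use D j in auto)
    moreover have "(\<lambda>z. \<lambda>i\<in>{2..m}. z (j i)) \<circ> (\<lambda>\<omega>. \<lambda>i\<in>j ` {2..m}. X i \<omega>) = ?V"
      by (auto simp: fun_eq_iff)
    ultimately show ?thesis by simp
  qed
  have V: "distr M (PiM {2..m} (\<lambda>_. borel)) ?V = PiM {2..m} (\<lambda>_. F)"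
    by (rule distr_tuple) (use j in \<open>auto intro: inj_on_subset\<close>)
  have f: "?f \<in> borel_measurable (PiM D (\<lambda>_. borel) \<Otimes>\<^sub>M PiM {2..m} (\<lambda>_. borel))"
  proof -
    have "(\<lambda>p. (fst p (j 1), snd p)) \<in> measurable (PiM D (\<lambda>_. borel) \<Otimes>\<^sub>M PiM {2..m} (\<lambda>_. borel))
        (borel \<Otimes>\<^sub>M PiM {2..m} (\<lambda>_. borel :: real measure))"
      by (intro measurable_Pair measurable_snd
          measurable_compose[OF measurable_fst measurable_component_singleton] D)
    from measurable_compose[OF this measurable_section[OF k]]
    have [measurable]: "(\<lambda>p. k ((snd p)(1 := fst p (j 1)))) \<in>
        borel_measurable (PiM D (\<lambda>_. borel) \<Otimes>\<^sub>M PiM {2..m} (\<lambda>_. borel))"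
      by simp
    note [measurable] = w
    show ?thesis unfolding case_prod_beta by measurable
  qed
  \<comment> \<open>The two independent blocks together rebuild the full argument of the
    kernel.\<close>
  have tup: "(?V \<omega>)(1 := ?W \<omega> (j 1)) = tuple j \<omega>" for \<omega>
    using m D(2) by (auto simp: fun_eq_iff tuple_def)
  have Wj: "?W \<omega> (j 1) = X (j 1) \<omega>" for \<omega> using D by simp
  have int': "integrable M (\<lambda>\<omega>. ?f (?W \<omega>, ?V \<omega>))"
    using int by (simp only: case_prod_conv tup)
  have cm: "(\<integral>y. ?f (?W \<omega>, y) \<partial>PiM {2..m} (\<lambda>_. F)) = cmean k (X (j 1) \<omega>) * w (?W \<omega>)" for \<omega>
    by (simp only: case_prod_conv Wj cmean_def integral_mult_left_zero)
  note F = indep_var_Fubini[OF indep f int', unfolded V cm]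
  show "integrable M (\<lambda>\<omega>. cmean k (X (j 1) \<omega>) * w (?W \<omega>))"
    by (rule F(1))
  show "expectation (\<lambda>\<omega>. cmean k (X (j 1) \<omega>) * w (?W \<omega>)) = expectation (\<lambda>\<omega>. k (tuple j \<omega>) * w (?W \<omega>))"
    using F(2) by (simp only: case_prod_conv tup)
  show "AE \<omega> in M. integrable (PiM {2..m} (\<lambda>_. F)) (\<lambda>y. k (y(1 := X (j 1) \<omega>)) * w (?W \<omega>))"
    using F(3) by (simp only: case_prod_conv Wj)
qed

end

section \<open>Deviations of a kernel from its conditional mean\<close>

context iid_sample
begin

lemma tuples_atD:
  assumes "j \<in> tuples_at m n i"
  shows "inj_on j {1..m}" "j ` {1..m} \<subseteq> {1..n}" "i \<in> j ` {1..m}" "card (j ` {1..m}) = m"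
    "i \<ge> 1" "i \<le> n" "j \<in> {1..m} \<rightarrow> {1..}"
proof -
  have "j \<in> increasing_tuples m {1..n}" and i: "i \<in> j ` {1..m}"
    using assms by (auto simp: tuples_at_def)
  note j = increasing_tuplesD[OF this(1)]
  show "inj_on j {1..m}" "j ` {1..m} \<subseteq> {1..n}" "i \<in> j ` {1..m}" "card (j ` {1..m}) = m"
    using j i by auto
  then show "i \<ge> 1" "i \<le> n" "j \<in> {1..m} \<rightarrow> {1..}" by fastforce+
qed

text \<open>In an increasing tuple \<open>i\<close> may sit at any position, while
  \<open>cmean\<close> conditions on the first. Transposing two positions brings \<open>i\<close> to
  the front; monotonicity may be lost, but injectivity is kept and symmetry preserves the kernel
  value.\<close>

lemma tuples_at_rotate:
  assumes "j \<in> tuples_at m n i" "symmetric_kernel m k"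
  obtains j' where "inj_on j' {1..m}" "j' \<in> {1..m} \<rightarrow> {1..}" "j' 1 = i"
    "j' ` {2..m} = j ` {1..m} - {i}"
    "\<And>\<omega>. k (tuple j' \<omega>) = k (tuple j \<omega>)"
proof -
  note j = tuples_atD[OF assms(1)]
  obtain p where p: "p \<in> {1..m}" "j p = i" using j(3) by auto
  define \<tau> where "\<tau> = Transposition.transpose 1 p"
  have \<tau>: "\<tau> permutes {1..m}"
    unfolding \<tau>_def using p m by (intro permutes_swap_id) auto
  have im: "\<tau> ` {1..m} = {1..m}" using \<tau> by (rule permutes_image)
  define j' where "j' = j \<circ> \<tau>"
  have "inj_on j' {1..m}"
    unfolding j'_def by (rule comp_inj_on) (use permutes_inj_on[OF \<tau>] im j(1) in simp_all)
  moreover have "j' ` {1..m} = j ` {1..m}"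
    unfolding j'_def image_comp[symmetric] im ..
  moreover have "j' 1 = i" using p by (simp add: j'_def \<tau>_def)
  ultimately have j': "inj_on j' {1..m}" "j' ` {1..m} = j ` {1..m}" "j' 1 = i" by auto
  have "{1..m} = insert 1 {2..m}" using m by auto
  then have "j' ` {2..m} = j ` {1..m} - {i}"
    using j' by (auto simp: inj_on_def image_iff)
  moreover have "j' \<in> {1..m} \<rightarrow> {1..}" unfolding Pi_iff
  proof
    fix p assume "p \<in> {1..m}"
    then have "j' p \<in> j ` {1..m}" unfolding j'(2)[symmetric] by (rule imageI)
    then show "j' p \<in> {1..}" using j(7) by (auto simp: Pi_iff)
  qed
  moreover have "k (tuple j' \<omega>) = k (tuple j \<omega>)" for \<omega>
  proof -
    have "tuple j' \<omega> = tuple j \<omega> \<circ> \<tau>"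
      using permutes_in_image[OF \<tau>] by (auto simp: fun_eq_iff j'_def restrict_def tuple_def)
    moreover have "k (tuple j \<omega> \<circ> \<tau>) = k (tuple j \<omega>)"
      using assms(2) \<tau> by (auto simp: symmetric_kernel_def space_PiM tuple_def)
    ultimately show ?thesis by simp
  qed
  ultimately show ?thesis using that j' by blast
qed

definition dev :: "((nat \<Rightarrow> real) \<Rightarrow> real) \<Rightarrow> nat \<Rightarrow> (nat \<Rightarrow> nat) \<Rightarrow> 'a \<Rightarrow> real" where
  "dev k i j \<omega> = k (tuple j \<omega>) - cmean k (X i \<omega>)"

text \<open>For a sample index and \<open>n \<ge> m\<close> this is the point average minus the
  conditional mean; written as a sum of deviations it is ready for the variance computation.\<close>

definition avg_dev :: "((nat \<Rightarrow> real) \<Rightarrow> real) \<Rightarrow> nat \<Rightarrow> nat \<Rightarrow> 'a \<Rightarrow> real" where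
  "avg_dev k n i \<omega> = (\<Sum>j\<in>tuples_at m n i. dev k i j \<omega>) / real ((n - 1) choose (m - 1))"

lemma random_variable_kernel:
  assumes "k \<in> borel_measurable (PiM {1..m} (\<lambda>_. borel))" "j \<in> {1..m} \<rightarrow> {1..}"
  shows "(\<lambda>\<omega>. k (tuple j \<omega>)) \<in> borel_measurable M"
  using measurable_compose[OF measurable_tuple[OF assms(2)] assms(1)] .

lemma random_variable_cmean:
  assumes "k \<in> borel_measurable (PiM {1..m} (\<lambda>_. borel))" "i \<ge> 1"
  shows "(\<lambda>\<omega>. cmean k (X i \<omega>)) \<in> borel_measurable M"
  using measurable_compose[OF measurable_X[OF assms(2)] borel_measurable_cmean[OF assms(1)]] .

lemma random_variable_dev:
  assumes "k \<in> borel_measurable (PiM {1..m} (\<lambda>_. borel))" "j \<in> tuples_at m n i"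
  shows "dev k i j \<in> borel_measurable M"
  using random_variable_kernel[OF assms(1)] random_variable_cmean[OF assms(1)] tuples_atD[OF assms(2)]
  unfolding dev_def[abs_def] by (intro borel_measurable_diff) auto

lemma random_variable_avg_dev:
  assumes "k \<in> borel_measurable (PiM {1..m} (\<lambda>_. borel))"
  shows "avg_dev k n i \<in> borel_measurable M"
  unfolding avg_dev_def[abs_def]
  by (intro borel_measurable_divide borel_measurable_sum random_variable_dev assms) auto

lemma
  fixes k :: "(nat \<Rightarrow> real) \<Rightarrow> real"
  assumes k: "k \<in> borel_measurable (PiM {1..m} (\<lambda>_. borel))"
    and int: "integrable M (\<lambda>\<omega>. k (tuple (\<lambda>i. i) \<omega>))" and i: "i \<ge> 1"
  shows integrable_cmean: "integrable M (\<lambda>\<omega>. cmean k (X i \<omega>))"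
    and expectation_cmean: "expectation (\<lambda>\<omega>. cmean k (X i \<omega>)) = expectation (\<lambda>\<omega>. k (tuple (\<lambda>i. i) \<omega>))"
    and AE_integrable_section: "AE \<omega> in M. integrable (PiM {2..m} (\<lambda>_. F)) (\<lambda>y. k (y(1 := X i \<omega>)))"
proof -
  \<comment> \<open>An injective choice of positive indices that starts with \<open>i\<close> and
    avoids it at positions 2 to \<open>m\<close>; the test function is then the constant 1.\<close>
  define j where "j = Transposition.transpose 1 i"
  have j: "inj_on j {1..m}" "j \<in> {1..m} \<rightarrow> {1..}" "j 1 = i"
    using i by (auto simp: j_def inj_on_def Transposition.transpose_def split: if_splits)
  have D: "{i} \<subseteq> {1..}" "j 1 \<in> {i}" "{i} \<inter> j ` {2..m} = {}"
    using i by (auto simp: j_def Transposition.transpose_def split: if_splits)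
  have int': "integrable M (\<lambda>\<omega>. k (tuple j \<omega>) * (\<lambda>_. 1) (\<lambda>i\<in>{i}. X i \<omega>))"
    using integrable_tuple_iff[OF j(1,2) k] int by simp
  note * = j(1,2) D k borel_measurable_const int'
  show "integrable M (\<lambda>\<omega>. cmean k (X i \<omega>))"
    using integrable_cmean_mult[OF *, unfolded j(3)] by simp
  show "expectation (\<lambda>\<omega>. cmean k (X i \<omega>)) = expectation (\<lambda>\<omega>. k (tuple (\<lambda>i. i) \<omega>))"
    using expectation_cmean_mult[OF *, unfolded j(3)] expectation_tuple[OF j(1,2) k] by simp
  show "AE \<omega> in M. integrable (PiM {2..m} (\<lambda>_. F)) (\<lambda>y. k (y(1 := X i \<omega>)))"
    using AE_integrable_section_mult[OF *, unfolded j(3) mult_1_right] .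
qed

lemma abs_cmean_le:
  assumes "\<And>x. \<bar>k x\<bar> \<le> B"
  shows "\<bar>cmean k x\<bar> \<le> B"
proof -
  interpret Q: prob_space "PiM {2..m} (\<lambda>_. F)" by (rule prob_space_section)
  have k: "k y \<le> B" "- B \<le> k y" for y using assms[of y] by linarith+
  \<comment> \<open>Needed for non-integrable sections, where the integral takes the value
    0.\<close>
  have "B \<ge> 0" using assms[of undefined] by linarith
  show ?thesis
  proof (cases "integrable (PiM {2..m} (\<lambda>_. F)) (\<lambda>y. k (y(1 := x)))")
    case True
    then show ?thesis
      unfolding cmean_def using k
      by (intro abs_leI) (auto intro!: Q.integral_le_const simp: minus_le_iff intro!: Q.integral_ge_const)
  next
    case False
    then show ?thesis using \<open>B \<ge> 0\<close> by (simp add: cmean_def not_integrable_integral_eq)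
  qed
qed

text \<open>Triangle inequality only, without cancellation: the kernel and its conditional mean each
  contribute at most the first absolute moment. This serves the part of the kernel above the
  truncation level.\<close>

lemma expectation_avg_dev_le:
  assumes k: "k \<in> borel_measurable (PiM {1..m} (\<lambda>_. borel))"
    and int: "integrable M (\<lambda>\<omega>. k (tuple (\<lambda>i. i) \<omega>))" and i: "i \<in> {1..n}" and n: "n \<ge> m"
  shows "integrable M (avg_dev k n i)"
    and "expectation (\<lambda>\<omega>. \<bar>avg_dev k n i \<omega>\<bar>) \<le> 2 * expectation (\<lambda>\<omega>. \<bar>k (tuple (\<lambda>i. i) \<omega>)\<bar>)"
proof -
  define E where "E = expectation (\<lambda>\<omega>. \<bar>k (tuple (\<lambda>i. i) \<omega>)\<bar>)"
  have i1: "i \<ge> 1" using i by simp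
  have ka: "(\<lambda>x. \<bar>k x\<bar>) \<in> borel_measurable (PiM {1..m} (\<lambda>_. borel))"
    using k by measurable
  have inta: "integrable M (\<lambda>\<omega>. \<bar>k (tuple (\<lambda>i. i) \<omega>)\<bar>)" using int by simp
  have c: "real ((n - 1) choose (m - 1)) > 0"
    using n m by (simp add: zero_less_binomial)
  have cm: "expectation (\<lambda>\<omega>. \<bar>cmean k (X i \<omega>)\<bar>) \<le> E"
  proof -
    have "expectation (\<lambda>\<omega>. \<bar>cmean k (X i \<omega>)\<bar>) \<le> expectation (\<lambda>\<omega>. cmean (\<lambda>x. \<bar>k x\<bar>) (X i \<omega>))"
    proof (rule integral_mono)
      show "\<bar>cmean k (X i \<omega>)\<bar> \<le> cmean (\<lambda>x. \<bar>k x\<bar>) (X i \<omega>)" for \<omega>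
        unfolding cmean_def by (rule integral_abs_bound)
    qed (use integrable_cmean[OF k int i1] integrable_cmean[OF ka inta i1] in auto)
    then show ?thesis using expectation_cmean[OF ka inta i1] by (simp add: E_def)
  qed
  have intj: "integrable M (\<lambda>\<omega>. k (tuple j \<omega>))" if "j \<in> tuples_at m n i" for j
    using integrable_tuple_iff[OF _ _ k] tuples_atD[OF that] int by simp
  have intd: "integrable M (dev k i j)" if "j \<in> tuples_at m n i" for j
    using intj[OF that] integrable_cmean[OF k int i1] unfolding dev_def[abs_def] by simp
  show "integrable M (avg_dev k n i)"
    unfolding avg_dev_def[abs_def] using intd by simp
  have dev: "expectation (\<lambda>\<omega>. \<bar>dev k i j \<omega>\<bar>) \<le> 2 * E" if "j \<in> tuples_at m n i" for j
  proof -
    have "expectation (\<lambda>\<omega>. \<bar>dev k i j \<omega>\<bar>) \<le> expectation (\<lambda>\<omega>. \<bar>k (tuple j \<omega>)\<bar> + \<bar>cmean k (X i \<omega>)\<bar>)"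
      using intj[OF that] integrable_cmean[OF k int i1] intd[OF that]
      by (intro integral_mono Bochner_Integration.integrable_add integrable_abs)
        (auto simp: dev_def intro: abs_triangle_ineq4)
    also have "\<dots> = E + expectation (\<lambda>\<omega>. \<bar>cmean k (X i \<omega>)\<bar>)"
      using intj[OF that] integrable_cmean[OF k int i1]
        expectation_tuple[OF tuples_atD(1)[OF that] tuples_atD(7)[OF that] ka]
      by (simp add: E_def)
    finally show ?thesis using cm by simp
  qed
  have "expectation (\<lambda>\<omega>. \<bar>avg_dev k n i \<omega>\<bar>)
      \<le> expectation (\<lambda>\<omega>. (\<Sum>j\<in>tuples_at m n i. \<bar>dev k i j \<omega>\<bar>) / real ((n - 1) choose (m - 1)))"
  proof (rule integral_mono)
    show "integrable M (\<lambda>\<omega>. (\<Sum>j\<in>tuples_at m n i. \<bar>dev k i j \<omega>\<bar>) / real ((n - 1) choose (m - 1)))"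
      using intd by (intro integrable_divide_zero Bochner_Integration.integrable_sum integrable_abs)
    show "\<bar>avg_dev k n i \<omega>\<bar> \<le> (\<Sum>j\<in>tuples_at m n i. \<bar>dev k i j \<omega>\<bar>) / real ((n - 1) choose (m - 1))" for \<omega>
      using c by (simp add: avg_dev_def divide_right_mono)
  qed (use \<open>integrable M (avg_dev k n i)\<close> in \<open>rule integrable_abs\<close>)
  also have "\<dots> = (\<Sum>j\<in>tuples_at m n i. expectation (\<lambda>\<omega>. \<bar>dev k i j \<omega>\<bar>)) / real ((n - 1) choose (m - 1))"
    using intd by (simp add: Bochner_Integration.integral_sum)
  also have "\<dots> \<le> (\<Sum>j\<in>tuples_at m n i. 2 * E) / real ((n - 1) choose (m - 1))"
    using dev by (intro divide_right_mono sum_mono) auto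
  also have "\<dots> = 2 * E"
    using c card_tuples_at[OF m i] by simp
  finally show "expectation (\<lambda>\<omega>. \<bar>avg_dev k n i \<omega>\<bar>) \<le> 2 * E" .
qed

end

section \<open>Orthogonality and second moments for bounded symmetric kernels\<close>

locale bounded_kernel = iid_sample +
  fixes k :: "(nat \<Rightarrow> real) \<Rightarrow> real" and B :: real
  assumes k: "k \<in> borel_measurable (PiM {1..m} (\<lambda>_. borel))"
    and sym: "symmetric_kernel m k" and bound: "\<And>x. \<bar>k x\<bar> \<le> B"
begin

lemma abs_cmean_bound: "\<bar>cmean k x\<bar> \<le> B"
  by (rule abs_cmean_le[OF bound])

lemma integrable_bounded_mult:
  fixes f g :: "'a \<Rightarrow> real"
  assumes "f \<in> borel_measurable M" "g \<in> borel_measurable M" "\<And>\<omega>. \<bar>f \<omega>\<bar> \<le> b" "\<And>\<omega>. \<bar>g \<omega>\<bar> \<le> c"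
  shows "integrable M (\<lambda>\<omega>. f \<omega> * g \<omega>)"
proof (rule integrable_const_bound[where B="b * c"])
  have "\<bar>f \<omega>\<bar> * \<bar>g \<omega>\<bar> \<le> b * c" for \<omega>
    using assms(3,4)[of \<omega>] by (intro mult_mono) auto
  then show "AE \<omega> in M. norm (f \<omega> * g \<omega>) \<le> b * c" by (simp add: abs_mult)
qed (use assms in simp)

text \<open>A deviation has conditional mean zero given every coordinate except the
  \<open>m - 1\<close> arguments other than \<open>i\<close>; \<open>D\<close> consists of exactly
  those admissible indices, including \<open>i\<close>.\<close>

lemma expectation_dev_mult_eq_0:
  assumes j: "j \<in> tuples_at m n i" and D: "D = {1..} - (j ` {1..m} - {i})"
    and w: "w \<in> borel_measurable (PiM D (\<lambda>_. borel))" and wb: "\<And>z. \<bar>w z\<bar> \<le> b"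
  shows "expectation (\<lambda>\<omega>. dev k i j \<omega> * w (\<lambda>i\<in>D. X i \<omega>)) = 0"
proof -
  obtain j' where j': "inj_on j' {1..m}" "j' \<in> {1..m} \<rightarrow> {1..}" "j' 1 = i"
    "j' ` {2..m} = j ` {1..m} - {i}"
    and eq: "\<And>\<omega>. k (tuple j' \<omega>) = k (tuple j \<omega>)"
    using tuples_at_rotate[OF j sym] by blast
  have i: "i \<ge> 1" using tuples_atD[OF j] by simp
  have D': "D \<subseteq> {1..}" "j' 1 \<in> D" "D \<inter> j' ` {2..m} = {}"
    using i j' by (auto simp: D)
  have W: "(\<lambda>\<omega>. w (\<lambda>i\<in>D. X i \<omega>)) \<in> borel_measurable M"
    by (rule measurable_compose[OF _ w], rule measurable_restrict, rule measurable_X) (auto simp: D)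
  have int: "integrable M (\<lambda>\<omega>. k (tuple j' \<omega>) * w (\<lambda>i\<in>D. X i \<omega>))"
    by (rule integrable_bounded_mult[OF random_variable_kernel[OF k j'(2)] W bound wb])
  have int2: "integrable M (\<lambda>\<omega>. cmean k (X i \<omega>) * w (\<lambda>i\<in>D. X i \<omega>))"
    by (rule integrable_bounded_mult[OF random_variable_cmean[OF k i] W abs_cmean_bound wb])
  show ?thesis
    unfolding dev_def left_diff_distrib Bochner_Integration.integral_diff[OF int[unfolded eq] int2]
    unfolding expectation_cmean_mult[OF j'(1,2) D' k w int, unfolded eq j'(3)] by (rule diff_self)
qed

lemma abs_dev_le: "\<bar>dev k i j \<omega>\<bar> \<le> 2 * B"
  using bound[of "tuple j \<omega>"] abs_cmean_bound[of "X i \<omega>"] by (simp add: dev_def)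

lemma integrable_dev_mult:
  assumes "j \<in> tuples_at m n i" "j' \<in> tuples_at m n i"
  shows "integrable M (\<lambda>\<omega>. dev k i j \<omega> * dev k i j' \<omega>)"
  by (rule integrable_bounded_mult[OF random_variable_dev[OF k assms(1)]
        random_variable_dev[OF k assms(2)] abs_dev_le abs_dev_le])

text \<open>If the two subsets meet only in \<open>i\<close>, the second deviation depends on
  coordinates in \<open>D\<close> alone, so it can serve as the bounded test function for the
  first.\<close>

lemma uncorrelated_dev:
  assumes j: "j \<in> tuples_at m n i" and j': "j' \<in> tuples_at m n i"
    and disj: "j ` {1..m} \<inter> j' ` {1..m} = {i}"
  shows "expectation (\<lambda>\<omega>. dev k i j \<omega> * dev k i j' \<omega>) = 0"
proof -
  define D where "D = {1..} - (j ` {1..m} - {i})"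
  define w where "w = (\<lambda>z. k (\<lambda>p\<in>{1..m}. z (j' p)) - cmean k (z i))"
  have i: "i \<in> D" using tuples_atD[OF j] by (auto simp: D_def)
  have j'D: "j' p \<in> D" if "p \<in> {1..m}" for p
  proof -
    have "j' p \<in> j' ` {1..m}" using that by (rule imageI)
    then have "j' p \<notin> j ` {1..m} - {i}" using disj by blast
    then show ?thesis using that tuples_atD(7)[OF j'] by (auto simp: D_def Pi_iff)
  qed
  have "w \<in> borel_measurable (PiM D (\<lambda>_. borel))"
    unfolding w_def
  proof (intro borel_measurable_diff)
    show "(\<lambda>z. k (\<lambda>p\<in>{1..m}. z (j' p))) \<in> borel_measurable (PiM D (\<lambda>_. borel))"
      by (rule measurable_compose[OF _ k], rule measurable_restrict, rule measurable_component_singleton)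
        (rule j'D)
    show "(\<lambda>z. cmean k (z i)) \<in> borel_measurable (PiM D (\<lambda>_. borel))"
      by (rule measurable_compose[OF measurable_component_singleton[OF i] borel_measurable_cmean[OF k]])
  qed
  moreover have "\<bar>w z\<bar> \<le> 2 * B" for z
    using bound[of "\<lambda>p\<in>{1..m}. z (j' p)"] abs_cmean_bound[of "z i"] by (simp add: w_def)
  moreover have "w (\<lambda>i\<in>D. X i \<omega>) = dev k i j' \<omega>" for \<omega>
  proof -
    have "(\<lambda>p\<in>{1..m}. (\<lambda>i\<in>D. X i \<omega>) (j' p)) = tuple j' \<omega>"
      using j'D by (auto simp: fun_eq_iff restrict_def tuple_def)
    then show ?thesis using i by (simp add: w_def dev_def)
  qed
  ultimately show ?thesis
    using expectation_dev_mult_eq_0[OF j D_def, of w "2 * B"] by simp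
qed

text \<open>Pythagoras: the kernel is the sum of its deviation and its conditional mean, and these
  are orthogonal.\<close>

lemma second_moment_dev_le:
  assumes j: "j \<in> tuples_at m n i"
  shows "expectation (\<lambda>\<omega>. (dev k i j \<omega>)\<^sup>2) \<le> expectation (\<lambda>\<omega>. (k (tuple (\<lambda>i. i) \<omega>))\<^sup>2)"
proof -
  define D where "D = {1..} - (j ` {1..m} - {i})"
  have i: "i \<in> D" "i \<ge> 1" using tuples_atD[OF j] by (auto simp: D_def)
  have 0: "expectation (\<lambda>\<omega>. dev k i j \<omega> * cmean k (X i \<omega>)) = 0"
    using expectation_dev_mult_eq_0[OF j D_def, of "\<lambda>z. cmean k (z i)" B] i
      abs_cmean_bound
      measurable_compose[OF measurable_component_singleton[OF i(1)] borel_measurable_cmean[OF k]]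
    by simp
  have int: "integrable M (\<lambda>\<omega>. dev k i j \<omega> * cmean k (X i \<omega>))"
    by (rule integrable_bounded_mult[OF random_variable_dev[OF k j] random_variable_cmean[OF k i(2)]
          abs_dev_le abs_cmean_bound])
  have int2: "integrable M (\<lambda>\<omega>. (dev k i j \<omega>)\<^sup>2)"
    using integrable_dev_mult[OF j j] by (simp add: power2_eq_square)
  have int3: "integrable M (\<lambda>\<omega>. (cmean k (X i \<omega>))\<^sup>2)"
    unfolding power2_eq_square
    by (rule integrable_bounded_mult[OF random_variable_cmean[OF k i(2)] random_variable_cmean[OF k i(2)]
          abs_cmean_bound abs_cmean_bound])
  have "expectation (\<lambda>\<omega>. (k (tuple j \<omega>))\<^sup>2)
      = expectation (\<lambda>\<omega>. (dev k i j \<omega>)\<^sup>2 + 2 * (dev k i j \<omega> * cmean k (X i \<omega>)) + (cmean k (X i \<omega>))\<^sup>2)"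
    by (intro Bochner_Integration.integral_cong refl) (simp add: dev_def power2_eq_square algebra_simps)
  also have "\<dots> = expectation (\<lambda>\<omega>. (dev k i j \<omega>)\<^sup>2) + expectation (\<lambda>\<omega>. (cmean k (X i \<omega>))\<^sup>2)"
    using int int2 int3 0 by simp
  also have "\<dots> \<ge> expectation (\<lambda>\<omega>. (dev k i j \<omega>)\<^sup>2)" by simp
  finally have "expectation (\<lambda>\<omega>. (dev k i j \<omega>)\<^sup>2) \<le> expectation (\<lambda>\<omega>. (k (tuple j \<omega>))\<^sup>2)" .
  also have "\<dots> = expectation (\<lambda>\<omega>. (k (tuple (\<lambda>i. i) \<omega>))\<^sup>2)"
    using tuples_atD[OF j] k by (intro expectation_tuple) auto
  finally show ?thesis .
qed

lemma integrable_avg_dev_square: "integrable M (\<lambda>\<omega>. (avg_dev k n i \<omega>)\<^sup>2)"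
  unfolding avg_dev_def power_divide
  unfolding power2_eq_square sum_product
  by (intro integrable_divide_zero Bochner_Integration.integrable_sum integrable_dev_mult)

text \<open>In the expanded square, pairs of subsets meeting only in \<open>i\<close> contribute 0,
  and any other pair at most \<open>K\<close> by the arithmetic-geometric inequality. Each of the
  \<open>c\<close> subsets has at most \<open>(m - 1) * N\<close> such partners, a proportion of at
  most \<open>(m - 1)^2 / (n - 1)\<close>.\<close>

lemma second_moment_avg_dev_le:
  assumes i: "i \<in> {1..n}" and n: "n \<ge> m" "n \<ge> 2"
  shows "expectation (\<lambda>\<omega>. (avg_dev k n i \<omega>)\<^sup>2)
    \<le> (real m - 1)\<^sup>2 / (real n - 1) * expectation (\<lambda>\<omega>. (k (tuple (\<lambda>i. i) \<omega>))\<^sup>2)"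
proof -
  define K where "K = expectation (\<lambda>\<omega>. (k (tuple (\<lambda>i. i) \<omega>))\<^sup>2)"
  define T where "T = tuples_at m n i"
  define c where "c = real ((n - 1) choose (m - 1))"
  \<comment> \<open>For \<open>m = 1\<close> truncated subtraction makes this 1, which is harmless
    because only \<open>(m - 1) * N\<close> enters.\<close>
  define N where "N = (n - 2) choose (m - 2)"
  have K: "K \<ge> 0" unfolding K_def by simp
  have c: "c > 0" using n m by (simp add: c_def zero_less_binomial)
  have cov: "expectation (\<lambda>\<omega>. dev k i j \<omega> * dev k i j' \<omega>)
      \<le> (if j' \<in> {j' \<in> T. j ` {1..m} \<inter> j' ` {1..m} \<noteq> {i}} then K else 0)"
    if "j \<in> T" "j' \<in> T" for j j'
  proof (cases "j ` {1..m} \<inter> j' ` {1..m} = {i}")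
    case True
    then show ?thesis using uncorrelated_dev[of j n i j'] that K by (simp add: T_def)
  next
    case False
    have int: "integrable M (\<lambda>\<omega>. (dev k i l \<omega>)\<^sup>2)" if "l \<in> T" for l
      using integrable_dev_mult[of l n i l] that by (simp add: power2_eq_square T_def)
    have "expectation (\<lambda>\<omega>. dev k i j \<omega> * dev k i j' \<omega>)
        \<le> expectation (\<lambda>\<omega>. ((dev k i j \<omega>)\<^sup>2 + (dev k i j' \<omega>)\<^sup>2) / 2)"
    proof (rule integral_mono)
      show "dev k i j \<omega> * dev k i j' \<omega> \<le> ((dev k i j \<omega>)\<^sup>2 + (dev k i j' \<omega>)\<^sup>2) / 2" for \<omega>
        using sum_squares_bound[of "dev k i j \<omega>" "dev k i j' \<omega>"] by simp
    qed (use int that integrable_dev_mult[of j n i j'] in \<open>auto simp: T_def\<close>)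
    also have "\<dots> = (expectation (\<lambda>\<omega>. (dev k i j \<omega>)\<^sup>2) + expectation (\<lambda>\<omega>. (dev k i j' \<omega>)\<^sup>2)) / 2"
      using int that by simp
    also have "\<dots> \<le> (K + K) / 2"
      using second_moment_dev_le that by (intro divide_right_mono add_mono) (auto simp: K_def T_def)
    finally show ?thesis using False that by simp
  qed
  have count: "card {j' \<in> T. j ` {1..m} \<inter> j' ` {1..m} \<noteq> {i}} \<le> (m - 1) * N" if "j \<in> T" for j
  proof -
    note j = tuples_atD[OF that[unfolded T_def]]
    \<comment> \<open>A partner meeting \<open>j\<close> outside \<open>i\<close> contains one of
      the \<open>m - 1\<close> other points \<open>s\<close> of \<open>j\<close>, and
      \<open>N\<close> subsets pass through both \<open>i\<close> and \<open>s\<close>.\<close>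
    have "{j' \<in> T. j ` {1..m} \<inter> j' ` {1..m} \<noteq> {i}} \<subseteq> (\<Union>s\<in>j ` {1..m} - {i}. {j' \<in> T. s \<in> j' ` {1..m}})"
    proof
      fix j' assume "j' \<in> {j' \<in> T. j ` {1..m} \<inter> j' ` {1..m} \<noteq> {i}}"
      then have j': "j' \<in> T" "j ` {1..m} \<inter> j' ` {1..m} \<noteq> {i}" by auto
      then have "i \<in> j ` {1..m} \<inter> j' ` {1..m}"
        using j(3) tuples_atD(3)[of j' n i] by (simp add: T_def)
      then obtain s where "s \<in> j ` {1..m} \<inter> j' ` {1..m}" "s \<noteq> i" using j'(2) by blast
      then show "j' \<in> (\<Union>s\<in>j ` {1..m} - {i}. {j' \<in> T. s \<in> j' ` {1..m}})" using j'(1) by blast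
    qed
    then have "card {j' \<in> T. j ` {1..m} \<inter> j' ` {1..m} \<noteq> {i}}
        \<le> card (\<Union>s\<in>j ` {1..m} - {i}. {j' \<in> T. s \<in> j' ` {1..m}})"
      by (intro card_mono) (auto simp: T_def)
    also have "\<dots> \<le> (\<Sum>s\<in>j ` {1..m} - {i}. card {j' \<in> T. s \<in> j' ` {1..m}})"
      by (intro card_UN_le) auto
    also have "\<dots> = (\<Sum>s\<in>j ` {1..m} - {i}. N)"
    proof (rule sum.cong[OF refl])
      fix s assume s: "s \<in> j ` {1..m} - {i}"
      then have "m \<noteq> 1" using j(3) by auto
      then have "m \<ge> 2" using m by simp
      then show "card {j' \<in> T. s \<in> j' ` {1..m}} = N"
        using s i j(2) unfolding T_def N_def by (intro card_tuples_at_two) auto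
    qed
    also have "\<dots> = (m - 1) * N" using j(3,4) by simp
    finally show ?thesis .
  qed
  have absorb: "(real n - 1) * real ((m - 1) * N) = (real m - 1)\<^sup>2 * c"
  proof (cases "m = 1")
    case False
    then have "Suc (m - 2) = m - 1" using m by simp
    then have "(m - 1) * ((n - 1) choose (m - 1)) = (n - 1) * N"
      using binomial_absorption[of "m - 2" "n - 1"] by (simp add: N_def numeral_2_eq_2)
    then have "real (m - 1) * c = real (n - 1) * real N"
      unfolding c_def by (metis of_nat_mult)
    then show ?thesis using m n by (simp add: of_nat_diff power2_eq_square mult_ac)
  qed simp
  have "expectation (\<lambda>\<omega>. (avg_dev k n i \<omega>)\<^sup>2)
      = (\<Sum>j\<in>T. \<Sum>j'\<in>T. expectation (\<lambda>\<omega>. dev k i j \<omega> * dev k i j' \<omega>)) / c\<^sup>2"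
    using integrable_dev_mult[of _ n i]
    by (simp add: avg_dev_def power_divide power2_eq_square sum_product T_def c_def
        Bochner_Integration.integral_sum)
  also have "\<dots> \<le> (\<Sum>j\<in>T. \<Sum>j'\<in>T. if j' \<in> {j' \<in> T. j ` {1..m} \<inter> j' ` {1..m} \<noteq> {i}} then K else 0) / c\<^sup>2"
    by (intro divide_right_mono sum_mono cov) auto
  also have "\<dots> = (\<Sum>j\<in>T. real (card {j' \<in> T. j ` {1..m} \<inter> j' ` {1..m} \<noteq> {i}}) * K) / c\<^sup>2"
    by (simp add: T_def sum.If_cases Int_def)
  also have "\<dots> \<le> (\<Sum>j\<in>T. real ((m - 1) * N) * K) / c\<^sup>2"
    using count K by (intro divide_right_mono sum_mono mult_right_mono) (auto simp del: of_nat_mult)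
  also have "\<dots> = c * (real ((m - 1) * N) * K) / c\<^sup>2"
    using card_tuples_at[OF m i] by (simp add: T_def c_def)
  also have "\<dots> = real ((m - 1) * N) / c * K"
    using c by (simp add: power2_eq_square)
  also have "real ((m - 1) * N) / c = (real m - 1)\<^sup>2 / (real n - 1)"
    using absorb c n by (simp add: field_simps del: of_nat_mult)
  finally show ?thesis by (simp add: K_def)
qed

end

section \<open>Approximation by the projection\<close>

text \<open>A weakly convergent sequence is tight: the tail probabilities beyond \<open>K\<close>
  tend to those of the normal law, which are small for large \<open>K\<close>. On the rest,
  \<open>|a n| * K\<close> falls below any given bound.\<close>

lemma (in prob_space) conv_in_prob_weak_conv_null:
  assumes Z[measurable]: "\<And>n. Z n \<in> borel_measurable M"
    and wc: "weak_conv_m (\<lambda>n. distr M borel (Z n)) std_normal_distribution"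
    and a: "a \<longlonglongrightarrow> 0"
  shows "conv_in_prob M (\<lambda>n \<omega>. a n * Z n \<omega>) 0"
  unfolding conv_in_prob_def
proof (intro conjI allI impI)
  interpret N: real_distribution std_normal_distribution by (rule real_dist_normal_dist)
  define \<Phi> where "\<Phi> = cdf std_normal_distribution"
  \<comment> \<open>The normal law has a density, so its distribution function is continuous and
    convergence holds at every point.\<close>
  have atom: "measure std_normal_distribution {x} = 0" for x
  proof -
    have "emeasure std_normal_distribution {x} = 0"
      by (subst emeasure_density) (auto simp: nn_integral_indicator_singleton')
    then show ?thesis by (simp add: measure_def)
  qed
  have conv: "(\<lambda>n. cdf (distr M borel (Z n)) x) \<longlonglongrightarrow> \<Phi> x" for x
    using wc atom N.isCont_cdf unfolding weak_conv_m_def weak_conv_def \<Phi>_def by blast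
  fix \<epsilon> :: real assume "\<epsilon> > 0"
  show "(\<lambda>n. prob {\<omega> \<in> space M. \<bar>a n * Z n \<omega> - 0\<bar> > \<epsilon>}) \<longlonglongrightarrow> 0"
  proof (rule tendstoI)
    fix d :: real assume "d > 0"
    have tail: "((\<lambda>x. 1 - \<Phi> x + \<Phi> (- x)) \<longlongrightarrow> 1 - 1 + 0) at_top"
      unfolding \<Phi>_def
      by (intro tendsto_intros N.cdf_lim_at_top_prob
          filterlim_compose[OF N.cdf_lim_at_bot filterlim_uminus_at_bot_at_top])
    have "\<forall>\<^sub>F x in at_top. 1 - \<Phi> x + \<Phi> (- x) < d"
      using order_tendstoD(2)[OF tail, of d] \<open>d > 0\<close> by simp
    then obtain K where K: "K > 0" "1 - \<Phi> K + \<Phi> (- K) < d"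
      using eventually_conj[OF _ eventually_gt_at_top[of "0::real"]] eventually_happens'
      by (metis (no_types, lifting) trivial_limit_at_top_linorder)
    have "(\<lambda>n. 1 - cdf (distr M borel (Z n)) K + cdf (distr M borel (Z n)) (- K)) \<longlonglongrightarrow> 1 - \<Phi> K + \<Phi> (- K)"
      by (intro tendsto_intros conv)
    then have "\<forall>\<^sub>F n in sequentially. 1 - cdf (distr M borel (Z n)) K + cdf (distr M borel (Z n)) (- K) < d"
      using K(2) by (rule order_tendstoD(2))
    moreover have "\<forall>\<^sub>F n in sequentially. \<bar>a n\<bar> < \<epsilon> / K"
      using tendstoD[OF a, of "\<epsilon> / K"] \<open>\<epsilon> > 0\<close> K by (simp add: dist_real_def)
    ultimately show "\<forall>\<^sub>F n in sequentially. dist (prob {\<omega> \<in> space M. \<bar>a n * Z n \<omega> - 0\<bar> > \<epsilon>}) 0 < d"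
    proof eventually_elim
      case (elim n)
      have "prob {\<omega> \<in> space M. \<bar>a n * Z n \<omega> - 0\<bar> > \<epsilon>}
          \<le> prob ((space M - {\<omega> \<in> space M. Z n \<omega> \<le> K}) \<union> {\<omega> \<in> space M. Z n \<omega> \<le> - K})"
      proof (rule finite_measure_mono)
        show "{\<omega> \<in> space M. \<bar>a n * Z n \<omega> - 0\<bar> > \<epsilon>}
          \<subseteq> (space M - {\<omega> \<in> space M. Z n \<omega> \<le> K}) \<union> {\<omega> \<in> space M. Z n \<omega> \<le> - K}"
        proof (safe, rule ccontr)
          fix \<omega> assume "\<epsilon> < \<bar>a n * Z n \<omega> - 0\<bar>" "\<not> Z n \<omega> \<le> - K" "Z n \<omega> \<le> K"
          then have "\<bar>Z n \<omega>\<bar> \<le> K" by linarith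
          then have "\<bar>a n\<bar> * \<bar>Z n \<omega>\<bar> \<le> \<epsilon> / K * K"
            using elim by (intro mult_mono) auto
          then show False using \<open>\<epsilon> < \<bar>a n * Z n \<omega> - 0\<bar>\<close> K by (simp add: abs_mult)
        qed
      qed auto
      also have "\<dots> \<le> prob (space M - {\<omega> \<in> space M. Z n \<omega> \<le> K}) + prob {\<omega> \<in> space M. Z n \<omega> \<le> - K}"
        by (intro measure_subadditive) (auto simp: emeasure_eq_measure)
      also have "\<dots> = 1 - cdf (distr M borel (Z n)) K + cdf (distr M borel (Z n)) (- K)"
        by (simp add: prob_compl cdf_def measure_distr vimage_def Int_def conj_commute)
      finally show ?case using elim by (simp add: dist_real_def measure_nonneg)
    qed
  qed
qed simp

text \<open>The parallel axis identity: the cross term vanishes because deviations from the mean add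
  up to 0.\<close>

lemma centred_sum_squares:
  fixes u :: "nat \<Rightarrow> real"
  assumes "n > 0"
  shows "(\<Sum>i=1..n. (u i - c)\<^sup>2)
    = (\<Sum>i=1..n. (u i - (\<Sum>k=1..n. u k) / real n)\<^sup>2) + real n * ((\<Sum>k=1..n. u k) / real n - c)\<^sup>2"
proof -
  define a where "a = (\<Sum>k=1..n. u k) / real n"
  have s: "(\<Sum>k=1..n. u k) = real n * a" using assms by (simp add: a_def)
  have "(\<Sum>i=1..n. (u i - c)\<^sup>2) = (\<Sum>i=1..n. (u i - a)\<^sup>2 + 2 * (a - c) * (u i - a) + (a - c)\<^sup>2)"
    by (intro sum.cong refl) (simp add: power2_eq_square algebra_simps)
  also have "\<dots> = (\<Sum>i=1..n. (u i - a)\<^sup>2) + 2 * (a - c) * (\<Sum>i=1..n. u i - a) + real n * (a - c)\<^sup>2"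
    by (simp add: sum.distrib sum_distrib_left)
  also have "(\<Sum>i=1..n. u i - a) = 0"
    using s by (simp add: sum_subtractf)
  finally show ?thesis by (simp add: a_def)
qed

text \<open>Centring is linear, so the centred \<open>v\<close> is the centred \<open>w\<close> plus
  the centred difference; Cauchy-Schwarz bounds the cross term. The constant \<open>c\<close> is
  free because the mean minimises the sum of squares, which is how \<theta> drops out later.\<close>

lemma centred_sum_squares_perturb:
  fixes v w :: "nat \<Rightarrow> real" and c :: real
  assumes n: "n > 0"
  defines "sv \<equiv> \<Sum>i=1..n. (v i - (\<Sum>k=1..n. v k) / real n)\<^sup>2"
    and "sw \<equiv> \<Sum>i=1..n. (w i - (\<Sum>k=1..n. w k) / real n)\<^sup>2"
    and "d \<equiv> \<Sum>i=1..n. (v i - w i - c)\<^sup>2"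
  shows "\<bar>sv - sw\<bar> \<le> d + 2 * (sqrt sw * sqrt d)"
proof -
  define p where "p = (\<lambda>i. w i - (\<Sum>k=1..n. w k) / real n)"
  define q where "q = (\<lambda>i. (v i - w i) - (\<Sum>k=1..n. v k - w k) / real n)"
  have pq: "v i - (\<Sum>k=1..n. v k) / real n = p i + q i" for i
    by (simp add: p_def q_def sum_subtractf diff_divide_distrib)
  have "sv = (\<Sum>i=1..n. (p i)\<^sup>2 + 2 * (p i * q i) + (q i)\<^sup>2)"
    unfolding sv_def pq by (intro sum.cong refl) (simp add: power2_sum)
  also have "\<dots> = sw + 2 * (\<Sum>i=1..n. p i * q i) + (\<Sum>i=1..n. (q i)\<^sup>2)"
    by (simp add: sum.distrib sum_distrib_left sw_def p_def)
  finally have sv: "sv - sw = 2 * (\<Sum>i=1..n. p i * q i) + (\<Sum>i=1..n. (q i)\<^sup>2)" by simp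
  have sw: "sw = (\<Sum>i=1..n. (p i)\<^sup>2)" by (simp add: sw_def p_def)
  have qd: "(\<Sum>i=1..n. (q i)\<^sup>2) \<le> d"
    using centred_sum_squares[OF n, of "\<lambda>i. v i - w i" c] by (simp add: d_def q_def)
  have "\<bar>\<Sum>i=1..n. p i * q i\<bar> = sqrt ((\<Sum>i=1..n. p i * q i)\<^sup>2)" by simp
  also have "\<dots> \<le> sqrt ((\<Sum>i=1..n. (p i)\<^sup>2) * (\<Sum>i=1..n. (q i)\<^sup>2))"
    by (intro real_sqrt_le_mono Cauchy_Schwarz_ineq_sum)
  also have "\<dots> \<le> sqrt (sw * d)"
    unfolding sw by (intro real_sqrt_le_mono mult_left_mono qd sum_nonneg) auto
  finally have "\<bar>\<Sum>i=1..n. p i * q i\<bar> \<le> sqrt sw * sqrt d" by (simp add: real_sqrt_mult)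
  moreover have "(\<Sum>i=1..n. (q i)\<^sup>2) \<ge> 0" by (intro sum_nonneg) auto
  ultimately show ?thesis using sv qd by linarith
qed

section \<open>The projection of the kernel and the approximation error\<close>

context iid_sample
begin

text \<open>Integrating over the events that \<open>X 1\<close> lies in a Borel set identifies the
  conditional expectation as \<open>cmean h - \<theta>\<close>. The set where \<open>h1\<close>
  differs from it is then null for the common law \<open>F\<close>, so the identity passes from
  \<open>X 1\<close> to every \<open>X i\<close>.\<close>

lemma AE_cond_exp_eq_cmean:
  assumes h: "h \<in> borel_measurable (PiM {1..m} (\<lambda>_. borel))"
    and int: "integrable M (\<lambda>\<omega>. h (tuple (\<lambda>i. i) \<omega>))"
    and h1: "is_cond_exp_given M (\<lambda>\<omega>. h (tuple (\<lambda>i. i) \<omega>) - \<theta>) (X 1) h1"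
    and i: "i \<ge> 1"
  shows "AE \<omega> in M. h1 (X i \<omega>) = cmean h (X i \<omega>) - \<theta>"
proof -
  define G where "G = vimage_algebra (space M) (X 1) borel"
  have X1[measurable]: "X 1 \<in> borel_measurable M" by (rule measurable_X) simp
  have sub: "subalgebra M G"
    unfolding subalgebra_def G_def
    using sets_image_in_sets[OF refl X1] by (simp add: space_vimage_algebra)
  interpret G: finite_measure_subalgebra M G
    by unfold_locales (rule sub)
  have cm[measurable]: "cmean h \<in> borel_measurable borel" by (rule borel_measurable_cmean[OF h])
  have h1m[measurable]: "h1 \<in> borel_measurable borel" using h1 by (simp add: is_cond_exp_given_def)
  have intc: "integrable M (\<lambda>\<omega>. cmean h (X 1 \<omega>))"
    using integrable_cmean[OF h int] by simp
  have "AE \<omega> in M. real_cond_exp M G (\<lambda>\<omega>. h (tuple (\<lambda>i. i) \<omega>) - \<theta>) \<omega> = cmean h (X 1 \<omega>) - \<theta>"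
  proof (rule G.real_cond_exp_charact)
    fix A assume "A \<in> sets G"
    then obtain C where C: "C \<in> sets borel" "A = X 1 -` C \<inter> space M"
      unfolding G_def by (auto simp: sets_vimage_algebra2)
    have A[measurable]: "A \<in> sets M" unfolding C(2) using X1 C(1) by (rule measurable_sets)
    \<comment> \<open>The indicator of \<open>A\<close> as a function of the first coordinate, in
      the form required of a test function.\<close>
    define w where "w = (\<lambda>z :: nat \<Rightarrow> real. indicator C (z 1) :: real)"
    have w: "w \<in> borel_measurable (PiM {1} (\<lambda>_. borel))"
      unfolding w_def
      by (rule measurable_compose[OF _ borel_measurable_indicator[OF C(1)]],
          rule measurable_component_singleton) simp
    have wA: "w (\<lambda>i\<in>{1}. X i \<omega>) = indicator A \<omega>" if "\<omega> \<in> space M" for \<omega>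
      using that by (simp add: w_def C(2) indicator_def)
    have intA: "integrable M (\<lambda>\<omega>. h (tuple (\<lambda>i. i) \<omega>) * indicator A \<omega>)"
      using integrable_mult_indicator[OF A int] by (simp add: mult.commute)
    have intA2: "integrable M (\<lambda>\<omega>. cmean h (X 1 \<omega>) * indicator A \<omega>)"
      using integrable_mult_indicator[OF A intc] by (simp add: mult.commute)
    have intw: "integrable M (\<lambda>\<omega>. h (tuple (\<lambda>i. i) \<omega>) * w (\<lambda>i\<in>{1}. X i \<omega>))"
      using intA wA by (subst Bochner_Integration.integrable_cong[OF refl]) auto
    have "expectation (\<lambda>\<omega>. cmean h (X 1 \<omega>) * w (\<lambda>i\<in>{1}. X i \<omega>))
        = expectation (\<lambda>\<omega>. h (tuple (\<lambda>i. i) \<omega>) * w (\<lambda>i\<in>{1}. X i \<omega>))"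
      by (rule expectation_cmean_mult[OF _ _ _ _ _ h w intw]) auto
    moreover have "expectation (\<lambda>\<omega>. cmean h (X 1 \<omega>) * w (\<lambda>i\<in>{1}. X i \<omega>))
        = expectation (\<lambda>\<omega>. cmean h (X 1 \<omega>) * indicator A \<omega>)"
      by (rule Bochner_Integration.integral_cong[OF refl]) (simp only: wA)
    moreover have "expectation (\<lambda>\<omega>. h (tuple (\<lambda>i. i) \<omega>) * w (\<lambda>i\<in>{1}. X i \<omega>))
        = expectation (\<lambda>\<omega>. h (tuple (\<lambda>i. i) \<omega>) * indicator A \<omega>)"
      by (rule Bochner_Integration.integral_cong[OF refl]) (simp only: wA)
    ultimately have eq: "expectation (\<lambda>\<omega>. cmean h (X 1 \<omega>) * indicator A \<omega>)
        = expectation (\<lambda>\<omega>. h (tuple (\<lambda>i. i) \<omega>) * indicator A \<omega>)" by simp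
    have intt: "integrable M (\<lambda>\<omega>. \<theta> * indicator A \<omega>)"
      by (intro integrable_mult_right) (simp add: emeasure_eq_measure)
    show "(\<integral>\<omega>\<in>A. (h (tuple (\<lambda>i. i) \<omega>) - \<theta>) \<partial>M) = (\<integral>\<omega>\<in>A. (cmean h (X 1 \<omega>) - \<theta>) \<partial>M)"
      using eq intA intA2 intt
      by (simp add: set_lebesgue_integral_def right_diff_distrib mult.commute)
  next
    show "(\<lambda>\<omega>. cmean h (X 1 \<omega>) - \<theta>) \<in> borel_measurable G"
      unfolding G_def
      by (intro borel_measurable_diff measurable_compose[OF measurable_vimage_algebra1 cm]) auto
  qed (use int intc in auto)
  moreover have "AE \<omega> in M. h1 (X 1 \<omega>) = real_cond_exp M G (\<lambda>\<omega>. h (tuple (\<lambda>i. i) \<omega>) - \<theta>) \<omega>"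
    using h1 by (simp add: is_cond_exp_given_def G_def)
  ultimately have "AE \<omega> in M. h1 (X 1 \<omega>) = cmean h (X 1 \<omega>) - \<theta>" by auto
  moreover have "(AE x in F. h1 x = cmean h x - \<theta>) \<longleftrightarrow> (AE \<omega> in M. h1 (X k \<omega>) = cmean h (X k \<omega>) - \<theta>)"
    if "k \<ge> 1" for k
  proof -
    have "(AE x in distr M borel (X k). h1 x = cmean h x - \<theta>)
        \<longleftrightarrow> (AE \<omega> in M. h1 (X k \<omega>) = cmean h (X k \<omega>) - \<theta>)"
      by (rule AE_distr_iff[OF measurable_X[OF that]]) measurable
    then show ?thesis unfolding distr_X[OF that] .
  qed
  ultimately show ?thesis using i by blast
qed

lemma random_variable_point_avg:
  assumes h: "h \<in> borel_measurable (PiM {1..m} (\<lambda>_. borel))"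
  shows "(\<lambda>\<omega>. point_avg m h (\<lambda>j. X j \<omega>) n i) \<in> borel_measurable M"
  unfolding point_avg_def tuple_def[symmetric]
  by (intro borel_measurable_divide borel_measurable_sum borel_measurable_const
      random_variable_kernel[OF h] tuples_atD(7))

text \<open>The truncated part is controlled in \<open>L\<^sup>2\<close>, with mean of order
  \<open>n powr (1/3 - 1)\<close>. The rest is controlled in \<open>L\<^sup>1\<close>: summed over
  \<open>n\<close> indices and divided by \<open>sqrt n\<close> it has order
  \<open>n powr (1 - 2/3 - 1/2)\<close>, that is \<open>n powr (-1/6)\<close>.\<close>

lemma conv_in_prob_point_avg:
  assumes h: "h \<in> borel_measurable (PiM {1..m} (\<lambda>_. borel))" and sym: "symmetric_kernel m h"
    and int: "integrable M (\<lambda>\<omega>. h (tuple (\<lambda>i. i) \<omega>))"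
    and intp: "integrable M (\<lambda>\<omega>. \<bar>h (tuple (\<lambda>i. i) \<omega>)\<bar> powr (5 / 3))"
  shows "conv_in_prob M
    (\<lambda>n \<omega>. (\<Sum>i=1..n. (point_avg m h (\<lambda>j. X j \<omega>) n i - cmean h (X i \<omega>))\<^sup>2) / real n) 0"
proof -
  define P where "P = expectation (\<lambda>\<omega>. \<bar>h (tuple (\<lambda>i. i) \<omega>)\<bar> powr (5 / 3))"
  define lo where "lo = (\<lambda>(n::nat) x. if \<bar>h x\<bar> \<le> real n then h x else 0)"
  define hi where "hi = (\<lambda>(n::nat) x. if \<bar>h x\<bar> \<le> real n then 0 else h x)"
  have lo[measurable]: "lo n \<in> borel_measurable (PiM {1..m} (\<lambda>_. borel))" for n
    unfolding lo_def using h by measurable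
  have hi[measurable]: "hi n \<in> borel_measurable (PiM {1..m} (\<lambda>_. borel))" for n
    unfolding hi_def using h by measurable
  have lo_sym: "symmetric_kernel m (lo n)" for n
    unfolding lo_def by (rule symmetric_kernel_comp[OF sym])
  have bk: "bounded_kernel M X F m (lo n) (real n)" for n
    by unfold_locales (rule lo, rule lo_sym, simp add: lo_def)
  have rv_lo: "(\<lambda>\<omega>. lo n (tuple (\<lambda>i. i) \<omega>)) \<in> borel_measurable M" for n
    by (rule random_variable_kernel[OF lo]) auto
  have rv_hi: "(\<lambda>\<omega>. hi n (tuple (\<lambda>i. i) \<omega>)) \<in> borel_measurable M" for n
    by (rule random_variable_kernel[OF hi]) auto
  have int_lo: "integrable M (\<lambda>\<omega>. lo n (tuple (\<lambda>i. i) \<omega>))" for n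
    by (rule Bochner_Integration.integrable_bound[OF int rv_lo]) (auto simp: lo_def)
  have int_hi: "integrable M (\<lambda>\<omega>. hi n (tuple (\<lambda>i. i) \<omega>))" for n
    by (rule Bochner_Integration.integrable_bound[OF int rv_hi]) (auto simp: hi_def)
  have int_lo2: "integrable M (\<lambda>\<omega>. (lo n (tuple (\<lambda>i. i) \<omega>))\<^sup>2)" for n
  proof (rule integrable_const_bound[where B="(real n)\<^sup>2"])
    show "AE \<omega> in M. norm ((lo n (tuple (\<lambda>i. i) \<omega>))\<^sup>2) \<le> (real n)\<^sup>2"
      by (intro AE_I2) (auto simp: lo_def abs_le_square_iff[symmetric])
  qed (use rv_lo in auto)
  have lo_bound: "expectation (\<lambda>\<omega>. (lo n (tuple (\<lambda>i. i) \<omega>))\<^sup>2) \<le> real n powr (1/3) * P" for n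
  proof -
    have "(lo n x)\<^sup>2 \<le> real n powr (1/3) * \<bar>h x\<bar> powr (5/3)" for x
    proof (cases "\<bar>h x\<bar> \<le> real n \<and> h x \<noteq> 0")
      case True
      \<comment> \<open>The exponent 2 is split into the available 5/3 and an excess 1/3, which
        truncation bounds by a power of \<open>n\<close>.\<close>
      then have "(lo n x)\<^sup>2 = \<bar>h x\<bar> powr (1/3 + 5/3)"
        by (simp add: lo_def powr_numeral)
      also have "\<dots> = \<bar>h x\<bar> powr (1/3) * \<bar>h x\<bar> powr (5/3)" by (rule powr_add)
      also have "\<dots> \<le> real n powr (1/3) * \<bar>h x\<bar> powr (5/3)"
        using True by (intro mult_right_mono powr_mono2) auto
      finally show ?thesis .
    qed (auto simp: lo_def)
    then have "expectation (\<lambda>\<omega>. (lo n (tuple (\<lambda>i. i) \<omega>))\<^sup>2)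
        \<le> expectation (\<lambda>\<omega>. real n powr (1/3) * \<bar>h (tuple (\<lambda>i. i) \<omega>)\<bar> powr (5/3))"
      using intp int_lo2 by (intro integral_mono) auto
    then show ?thesis by (simp add: P_def)
  qed
  have hi_bound: "expectation (\<lambda>\<omega>. \<bar>hi n (tuple (\<lambda>i. i) \<omega>)\<bar>) \<le> real n powr (-2/3) * P"
    if "n \<ge> 1" for n
  proof -
    have "\<bar>hi n x\<bar> \<le> real n powr (-2/3) * \<bar>h x\<bar> powr (5/3)" for x
    proof (cases "\<bar>h x\<bar> \<le> real n")
      case False
      \<comment> \<open>Here 1 falls short of 5/3 by 2/3, and the negative power is largest at the
        truncation level.\<close>
      then have "\<bar>hi n x\<bar> = \<bar>h x\<bar> powr (-2/3 + 5/3)"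
        by (simp add: hi_def)
      also have "\<dots> = \<bar>h x\<bar> powr (-2/3) * \<bar>h x\<bar> powr (5/3)" by (rule powr_add)
      also have "\<dots> \<le> real n powr (-2/3) * \<bar>h x\<bar> powr (5/3)"
        using False that by (intro mult_right_mono powr_mono2') auto
      finally show ?thesis .
    qed (auto simp: hi_def)
    then have "expectation (\<lambda>\<omega>. \<bar>hi n (tuple (\<lambda>i. i) \<omega>)\<bar>)
        \<le> expectation (\<lambda>\<omega>. real n powr (-2/3) * \<bar>h (tuple (\<lambda>i. i) \<omega>)\<bar> powr (5/3))"
      using intp int_hi by (intro integral_mono) auto
    then show ?thesis by (simp add: P_def)
  qed
  have P: "P \<ge> 0" unfolding P_def by simp
  have null: "(\<lambda>n. real n powr s) \<longlonglongrightarrow> 0" if "s < 0" for s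
    using that filterlim_real_sequentially by (rule tendsto_neg_powr)
  define A where "A = (\<lambda>n \<omega>. (\<Sum>i=1..n. (avg_dev (lo n) n i \<omega>)\<^sup>2) / real n)"
  have rvA: "A n \<in> borel_measurable M" for n
    unfolding A_def using random_variable_avg_dev[OF lo]
    by (intro borel_measurable_divide borel_measurable_sum borel_measurable_power) auto
  have intA: "integrable M (A n)" for n
    unfolding A_def using bounded_kernel.integrable_avg_dev_square[OF bk]
    by (intro integrable_divide_zero Bochner_Integration.integrable_sum)
  have convA: "conv_in_prob M A 0"
  proof (rule conv_in_prob_L1[OF rvA])
    show "(\<lambda>n. expectation (\<lambda>\<omega>. \<bar>A n \<omega>\<bar>)) \<longlonglongrightarrow> 0"
    proof (rule tendsto_sandwich[OF _ _ tendsto_const])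
      show "(\<lambda>n. 2 * (real m - 1)\<^sup>2 * P * real n powr (-2/3)) \<longlonglongrightarrow> 0"
        by (intro tendsto_mult_right_zero null) simp
      show "\<forall>\<^sub>F n in sequentially. expectation (\<lambda>\<omega>. \<bar>A n \<omega>\<bar>) \<le> 2 * (real m - 1)\<^sup>2 * P * real n powr (-2/3)"
        using eventually_ge_at_top[of "max m 2"]
      proof eventually_elim
        case (elim n)
        then have n: "n \<ge> m" "n \<ge> 2" by auto
        have "expectation (\<lambda>\<omega>. \<bar>A n \<omega>\<bar>) = (\<Sum>i=1..n. expectation (\<lambda>\<omega>. (avg_dev (lo n) n i \<omega>)\<^sup>2)) / real n"
          using bounded_kernel.integrable_avg_dev_square[OF bk]
          by (simp add: A_def sum_nonneg Bochner_Integration.integral_sum)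
        also have "\<dots> \<le> (\<Sum>i=1..n. (real m - 1)\<^sup>2 / (real n - 1) * (real n powr (1/3) * P)) / real n"
        proof (intro divide_right_mono sum_mono)
          fix i assume "i \<in> {1..n}"
          then have "expectation (\<lambda>\<omega>. (avg_dev (lo n) n i \<omega>)\<^sup>2)
            \<le> (real m - 1)\<^sup>2 / (real n - 1) * expectation (\<lambda>\<omega>. (lo n (tuple (\<lambda>i. i) \<omega>))\<^sup>2)"
            by (rule bounded_kernel.second_moment_avg_dev_le[OF bk _ n])
          also have "\<dots> \<le> (real m - 1)\<^sup>2 / (real n - 1) * (real n powr (1/3) * P)"
            using n by (intro mult_left_mono lo_bound) auto
          finally show "expectation (\<lambda>\<omega>. (avg_dev (lo n) n i \<omega>)\<^sup>2)
            \<le> (real m - 1)\<^sup>2 / (real n - 1) * (real n powr (1/3) * P)" .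
        qed simp
        also have "\<dots> = (real m - 1)\<^sup>2 * P * real n powr (1/3) / (real n - 1)"
          using n by simp
        \<comment> \<open>From \<open>n \<ge> 2\<close> follows \<open>n - 1 \<ge> n / 2\<close>,
          the source of the factor 2.\<close>
        also have "\<dots> \<le> (real m - 1)\<^sup>2 * P * real n powr (1/3) / (real n / 2)"
          using n P by (intro divide_left_mono) auto
        also have "\<dots> = 2 * (real m - 1)\<^sup>2 * P * (real n powr (1/3) / real n)" by simp
        also have "real n powr (1/3) / real n = real n powr (1/3 - 1)"
          using n by (simp only: powr_diff) simp
        finally show ?case by simp
      qed
    qed simp
  qed (use intA in simp)
  \<comment> \<open>Since a sum of squares is at most the square of the sum of absolute values, the
    square of \<open>B\<close> dominates the mean of squares, while \<open>B\<close> itself needs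
    only first moments.\<close>
  define B where "B = (\<lambda>n \<omega>. (\<Sum>i=1..n. \<bar>avg_dev (hi n) n i \<omega>\<bar>) / sqrt (real n))"
  have rvB: "B n \<in> borel_measurable M" for n
    unfolding B_def using random_variable_avg_dev[OF hi]
    by (intro borel_measurable_divide borel_measurable_sum borel_measurable_abs) auto
  have int_avg: "integrable M (\<lambda>\<omega>. \<bar>avg_dev (hi n) n i \<omega>\<bar>)" if "i \<in> {1..n}" "n \<ge> m" for n i
    using expectation_avg_dev_le(1)[OF hi int_hi that] by simp
  have convB: "conv_in_prob M B 0"
  proof (rule conv_in_prob_L1[OF rvB])
    show "\<forall>\<^sub>F n in sequentially. integrable M (B n)"
      using eventually_ge_at_top[of m] unfolding B_def
      by eventually_elim (intro integrable_divide_zero Bochner_Integration.integrable_sum int_avg)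
    show "(\<lambda>n. expectation (\<lambda>\<omega>. \<bar>B n \<omega>\<bar>)) \<longlonglongrightarrow> 0"
    proof (rule tendsto_sandwich[OF _ _ tendsto_const])
      show "(\<lambda>n. 2 * P * real n powr (-1/6)) \<longlonglongrightarrow> 0"
        by (intro tendsto_mult_right_zero null) simp
      show "\<forall>\<^sub>F n in sequentially. expectation (\<lambda>\<omega>. \<bar>B n \<omega>\<bar>) \<le> 2 * P * real n powr (-1/6)"
        using eventually_ge_at_top[of m]
      proof eventually_elim
        case (elim n)
        then have n: "n \<ge> 1" using m by simp
        have "expectation (\<lambda>\<omega>. \<bar>B n \<omega>\<bar>) = (\<Sum>i=1..n. expectation (\<lambda>\<omega>. \<bar>avg_dev (hi n) n i \<omega>\<bar>)) / sqrt (real n)"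
          using int_avg elim by (simp add: B_def sum_nonneg Bochner_Integration.integral_sum)
        also have "\<dots> \<le> (\<Sum>i=1..n. 2 * (real n powr (-2/3) * P)) / sqrt (real n)"
        proof (intro divide_right_mono sum_mono)
          fix i assume "i \<in> {1..n}"
          from expectation_avg_dev_le(2)[OF hi[of n] int_hi this elim] hi_bound[OF n]
          show "expectation (\<lambda>\<omega>. \<bar>avg_dev (hi n) n i \<omega>\<bar>) \<le> 2 * (real n powr (-2/3) * P)" by linarith
        qed simp
        also have "\<dots> = 2 * P * (real n powr 1 * real n powr (-2/3) / real n powr (1/2))"
          by (simp add: powr_half_sqrt)
        also have "real n powr 1 * real n powr (-2/3) / real n powr (1/2) = real n powr (1 + -2/3 - 1/2)"
          by (simp only: powr_diff powr_add)
        finally show ?case by simp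
      qed
    qed simp
  qed
  \<comment> \<open>The factors 2 come from
    \<open>(x + y)^2 \<le> 2 * x^2 + 2 * y^2\<close>.\<close>
  have "conv_in_prob M (\<lambda>n \<omega>. 2 * A n \<omega> + 2 * (B n \<omega> * B n \<omega>)) (2 * 0 + 2 * (0 * 0))"
    by (intro conv_in_prob_add conv_in_prob_mult conv_in_prob_const[OF tendsto_const] convA convB)
  then have dom: "conv_in_prob M (\<lambda>n \<omega>. 2 * A n \<omega> + 2 * (B n \<omega> * B n \<omega>)) 0" by simp
  \<comment> \<open>Additivity is available only where both sections are integrable, hence almost
    surely.\<close>
  have split: "AE \<omega> in M. cmean h (X i \<omega>) = cmean (lo n) (X i \<omega>) + cmean (hi n) (X i \<omega>)"
    if "i \<ge> 1" for i n
    using AE_integrable_section[OF lo int_lo that, of n] AE_integrable_section[OF hi int_hi that, of n]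
  proof eventually_elim
    case (elim \<omega>)
    have "cmean h (X i \<omega>) = (\<integral>y. lo n (y(1 := X i \<omega>)) + hi n (y(1 := X i \<omega>)) \<partial>PiM {2..m} (\<lambda>_. F))"
      unfolding cmean_def by (intro Bochner_Integration.integral_cong refl) (simp add: lo_def hi_def)
    also have "\<dots> = cmean (lo n) (X i \<omega>) + cmean (hi n) (X i \<omega>)"
      unfolding cmean_def by (rule Bochner_Integration.integral_add[OF elim])
    finally show ?case .
  qed
  show ?thesis
  proof (rule conv_in_prob_dominated[OF _ dom])
    show "(\<lambda>\<omega>. (\<Sum>i=1..n. (point_avg m h (\<lambda>j. X j \<omega>) n i - cmean h (X i \<omega>))\<^sup>2) / real n)
        \<in> borel_measurable M" for n
      by (intro borel_measurable_divide borel_measurable_sum borel_measurable_power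
          borel_measurable_diff random_variable_point_avg[OF h] random_variable_cmean[OF h]) auto
    show "\<forall>\<^sub>F n in sequentially. AE \<omega> in M.
      \<bar>(\<Sum>i=1..n. (point_avg m h (\<lambda>j. X j \<omega>) n i - cmean h (X i \<omega>))\<^sup>2) / real n - 0\<bar>
        \<le> 2 * A n \<omega> + 2 * (B n \<omega> * B n \<omega>)"
      using eventually_ge_at_top[of m]
    proof eventually_elim
      case (elim n)
      have "AE \<omega> in M. \<forall>i\<in>{1..n}. cmean h (X i \<omega>) = cmean (lo n) (X i \<omega>) + cmean (hi n) (X i \<omega>)"
        by (intro AE_finite_allI split) auto
      then show ?case
      proof eventually_elim
        case (elim \<omega>)
        have dev: "point_avg m h (\<lambda>j. X j \<omega>) n i - cmean h (X i \<omega>)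
            = avg_dev (lo n) n i \<omega> + avg_dev (hi n) n i \<omega>" if i: "i \<in> {1..n}" for i
        proof -
          define c where "c = real ((n - 1) choose (m - 1))"
          have c: "c > 0" using \<open>m \<le> n\<close> m by (simp add: c_def zero_less_binomial)
          have "avg_dev (lo n) n i \<omega> + avg_dev (hi n) n i \<omega>
            = (\<Sum>j\<in>tuples_at m n i. h (tuple j \<omega>) - cmean h (X i \<omega>)) / c"
            unfolding avg_dev_def c_def[symmetric] add_divide_distrib[symmetric] sum.distrib[symmetric]
            using elim i by (intro arg_cong[where f="\<lambda>x. x / c"] sum.cong refl)
              (simp add: dev_def lo_def hi_def)
          also have "\<dots> = (\<Sum>j\<in>tuples_at m n i. h (tuple j \<omega>)) / c - cmean h (X i \<omega>)"
            using card_tuples_at[OF m i] c by (simp add: sum_subtractf diff_divide_distrib c_def)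
          finally show ?thesis by (simp only: point_avg_def tuple_def c_def)
        qed
        have sq: "(\<Sum>i=1..n. (avg_dev (hi n) n i \<omega>)\<^sup>2) \<le> (\<Sum>i=1..n. \<bar>avg_dev (hi n) n i \<omega>\<bar>)\<^sup>2"
        proof -
          have "L2_set (\<lambda>i. avg_dev (hi n) n i \<omega>) {1..n} \<le> (\<Sum>i=1..n. \<bar>avg_dev (hi n) n i \<omega>\<bar>)"
            by (rule L2_set_le_sum_abs)
          then have "(L2_set (\<lambda>i. avg_dev (hi n) n i \<omega>) {1..n})\<^sup>2 \<le> (\<Sum>i=1..n. \<bar>avg_dev (hi n) n i \<omega>\<bar>)\<^sup>2"
            by (intro power_mono L2_set_nonneg)
          then show ?thesis by (simp add: L2_set_def sum_nonneg)
        qed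
        have "(\<Sum>i=1..n. (point_avg m h (\<lambda>j. X j \<omega>) n i - cmean h (X i \<omega>))\<^sup>2)
            \<le> (\<Sum>i=1..n. 2 * (avg_dev (lo n) n i \<omega>)\<^sup>2 + 2 * (avg_dev (hi n) n i \<omega>)\<^sup>2)"
        proof (rule sum_mono)
          fix i assume "i \<in> {1..n}"
          from dev[OF this]
          show "(point_avg m h (\<lambda>j. X j \<omega>) n i - cmean h (X i \<omega>))\<^sup>2
            \<le> 2 * (avg_dev (lo n) n i \<omega>)\<^sup>2 + 2 * (avg_dev (hi n) n i \<omega>)\<^sup>2"
            using sum_squares_bound[of "avg_dev (lo n) n i \<omega>" "avg_dev (hi n) n i \<omega>"]
            by (simp add: power2_sum)
        qed
        also have "\<dots> = 2 * (\<Sum>i=1..n. (avg_dev (lo n) n i \<omega>)\<^sup>2) + 2 * (\<Sum>i=1..n. (avg_dev (hi n) n i \<omega>)\<^sup>2)"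
          by (simp add: sum.distrib sum_distrib_left)
        also have "\<dots> \<le> 2 * (\<Sum>i=1..n. (avg_dev (lo n) n i \<omega>)\<^sup>2) + 2 * (\<Sum>i=1..n. \<bar>avg_dev (hi n) n i \<omega>\<bar>)\<^sup>2"
          using sq by simp
        finally have "(\<Sum>i=1..n. (point_avg m h (\<lambda>j. X j \<omega>) n i - cmean h (X i \<omega>))\<^sup>2) / real n
          \<le> (2 * (\<Sum>i=1..n. (avg_dev (lo n) n i \<omega>)\<^sup>2) + 2 * (\<Sum>i=1..n. \<bar>avg_dev (hi n) n i \<omega>\<bar>)\<^sup>2) / real n"
          by (intro divide_right_mono) auto
        also have "\<dots> = 2 * A n \<omega> + 2 * (B n \<omega> * B n \<omega>)"
          by (simp add: A_def B_def add_divide_distrib power2_eq_square)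
        finally show ?case by (simp add: sum_nonneg)
      qed
    qed
  qed
qed

end

section \<open>From the projection to the jackknife variance\<close>

theorem corollary1:
  fixes M :: "'a measure" and X :: "nat \<Rightarrow> 'a \<Rightarrow> real" and F :: "real measure"
    and m :: nat and h :: "(nat \<Rightarrow> real) \<Rightarrow> real" and \<theta> :: real
    and h1 :: "real \<Rightarrow> real" and l :: "real \<Rightarrow> real"
  assumes "prob_space M"
    and "m \<ge> 1"
    and "iid_seq M X F"
    and "nondegenerate M (X 1)"
    and "h \<in> borel_measurable (PiM {1..m} (\<lambda>_. borel))"
    and "symmetric_kernel m h"
    and "integrable M (\<lambda>\<omega>. h (\<lambda>k\<in>{1..m}. X k \<omega>))"
    and "\<theta> = prob_space.expectation M (\<lambda>\<omega>. h (\<lambda>k\<in>{1..m}. X k \<omega>))"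
    and "integrable M (\<lambda>\<omega>. \<bar>h (\<lambda>k\<in>{1..m}. X k \<omega>)\<bar> powr (5 / 3))"
    and "is_cond_exp_given M (\<lambda>\<omega>. h (\<lambda>k\<in>{1..m}. X k \<omega>) - \<theta>) (X 1) h1"
    and "DAN M (\<lambda>i \<omega>. h1 (X i \<omega>))"
    and "DAN_slowly_varying M (\<lambda>i \<omega>. h1 (X i \<omega>)) l"
  shows "conv_in_prob M
    (\<lambda>n \<omega>. (real n - 1) / ((real m)\<^sup>2 * (l (real n))\<^sup>2) *
       (\<Sum>i=1..n. (U_jack m h (\<lambda>j. X j \<omega>) n i - U_stat m h (\<lambda>j. X j \<omega>) n)\<^sup>2)) 1"
proof -
  interpret iid_sample M X F m
    using assms(1-3) by (simp add: iid_sample_def iid_sample_axioms_def)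
  have h: "h \<in> borel_measurable (PiM {1..m} (\<lambda>_. borel))" by fact
  have tup: "(\<lambda>k\<in>{1..m}. X k \<omega>) = tuple (\<lambda>i. i) \<omega>" for \<omega>
    by (simp add: tuple_def)
  note int = assms(7)[unfolded tup] and \<theta> = assms(8)[unfolded tup]
    and intp = assms(9)[unfolded tup] and h1 = assms(10)[unfolded tup]
  have h1m[measurable]: "h1 \<in> borel_measurable borel" using h1 by (simp add: is_cond_exp_given_def)
  define Y where "Y = (\<lambda>i \<omega>. h1 (X i \<omega>))"
  have Y: "Y i \<in> borel_measurable M" if "i \<ge> 1" for i
    unfolding Y_def using measurable_compose[OF measurable_X[OF that] h1m] .
  have iidY: "iid_seq M Y (distr M borel (Y 1))"
    using assms(11) by (simp add: DAN_def Y_def)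
  have cm: "AE \<omega> in M. Y i \<omega> = cmean h (X i \<omega>) - \<theta>" if "i \<ge> 1" for i
    unfolding Y_def by (rule AE_cond_exp_eq_cmean[OF h int h1 that])
  have intY: "integrable M (Y 1)"
  proof -
    have "integrable M (\<lambda>\<omega>. cmean h (X 1 \<omega>) - \<theta>)"
      using integrable_cmean[OF h int] by simp
    then show ?thesis
      by (subst integrable_cong_AE[OF Y borel_measurable_integrable cm]) auto
  qed
  have EY: "expectation (Y 1) = 0"
  proof -
    have "expectation (Y 1) = expectation (\<lambda>\<omega>. cmean h (X 1 \<omega>) - \<theta>)"
      using integrable_cmean[OF h int]
      by (intro integral_cong_AE[OF Y borel_measurable_integrable cm]) auto
    also have "\<dots> = 0"
      using integrable_cmean[OF h int] expectation_cmean[OF h int] \<theta> prob_space by simp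
    finally show ?thesis .
  qed
  note l = assms(12)[folded Y_def, unfolded DAN_slowly_varying_def]
  have lpos: "l x > 0" if "x > 0" for x
    using l that by (auto simp: slowly_varying_def)
  \<comment> \<open>With finite second moment \<open>l\<close> is constant along the positive
    integers; otherwise it diverges and only finitely many positive values remain to be bounded
    below.\<close>
  obtain c where c: "c > 0" "\<And>n. n \<ge> 1 \<Longrightarrow> l (real n) \<ge> c"
  proof (cases "integrable M (\<lambda>\<omega>. (Y 1 \<omega>)\<^sup>2)")
    case True
    then have "l (real n) = l (real 1)" if "n \<ge> 1" for n :: nat
      using l that by (metis order_refl)
    then show ?thesis using that[of "l (real 1)"] lpos[of "real 1"] by auto
  next
    case False
    then have "filterlim (\<lambda>n. l (real n)) at_top sequentially" using l by simp
    then obtain N where N: "\<And>n. n \<ge> N \<Longrightarrow> l (real n) \<ge> 1"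
      unfolding filterlim_at_top eventually_sequentially by blast
    \<comment> \<open>The entry 1 bounds the values from \<open>N\<close> on, the others are the
      initial values.\<close>
    define S where "S = insert 1 ((\<lambda>n. l (real n)) ` {1..N})"
    have S: "finite S" "S \<noteq> {}" by (auto simp: S_def)
    show ?thesis
    proof (rule that[of "Min S"])
      show "Min S > 0" using S lpos by (auto simp: S_def)
      fix n :: nat assume n: "n \<ge> 1"
      show "Min S \<le> l (real n)"
      proof (cases "n \<ge> N")
        case True
        have "Min S \<le> 1" by (rule Min_le[OF S(1)]) (simp add: S_def)
        then show ?thesis using N[OF True] by linarith
      next
        case False
        then show ?thesis using n by (intro Min_le[OF S(1)]) (auto simp: S_def)
      qed
    qed
  qed
  \<comment> \<open>Nothing is known about \<open>l\<close> at 0, so that value is replaced by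
    \<open>c\<close>; the factor \<open>sqrt n\<close> vanishes there and the normed sums do not
    change.\<close>
  define b where "b = (\<lambda>n. if n = 0 then c else l (real n))"
  have b: "b n \<ge> c" for n using c by (simp add: b_def)
  have b0: "b n > 0" for n using b[of n] c by linarith
  have lb: "sqrt (real n) * l (real n) = sqrt (real n) * b n" for n by (simp add: b_def)
  have clt: "weak_conv_m (\<lambda>n. distr M borel (\<lambda>\<omega>. (\<Sum>i=1..n. Y i \<omega>) / (sqrt (real n) * b n)))
      std_normal_distribution"
    using l EY by (simp add: lb)
  define Z where "Z = (\<lambda>n \<omega>. (\<Sum>i=1..n. Y i \<omega>) / (sqrt (real n) * b n))"
  have Z: "Z n \<in> borel_measurable M" for n
    unfolding Z_def by (intro borel_measurable_divide borel_measurable_sum Y borel_measurable_const) auto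
  have conv1: "conv_in_prob M (\<lambda>n \<omega>. (\<Sum>i=1..n. (Y i \<omega>)\<^sup>2) / (real n * (b n)\<^sup>2)) 1"
  proof (rule Raikov[OF _ _ intY EY c(1) b clt])
    show "indep_vars (\<lambda>_. borel) Y {1..}" using iidY by (simp only: iid_seq_def)
    show "distr M borel (Y i) = distr M borel (Y 1)" if "i \<ge> 1" for i
      using iidY that unfolding iid_seq_def by blast
  qed
  \<comment> \<open>This is the sample mean of the \<open>Y i\<close> divided by \<open>b n\<close>;
    its square is the correction due to centring.\<close>
  have conv2: "conv_in_prob M (\<lambda>n \<omega>. 1 / sqrt (real n) * Z n \<omega>) 0"
  proof (rule conv_in_prob_weak_conv_null[OF Z])
    show "weak_conv_m (\<lambda>n. distr M borel (Z n)) std_normal_distribution"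
      using clt by (simp add: Z_def)
  qed (intro tendsto_divide_0[OF tendsto_const]
        filterlim_at_top_imp_at_infinity filterlim_compose[OF sqrt_at_top filterlim_real_sequentially])
  \<comment> \<open>For positive \<open>n\<close>, the empirical variance of the \<open>Y i\<close>
    over \<open>(b n)^2\<close>, written as mean square minus squared mean so that both limits
    apply.\<close>
  define W where "W = (\<lambda>n \<omega>. (\<Sum>i=1..n. (Y i \<omega>)\<^sup>2) / (real n * (b n)\<^sup>2)
      + (-1) * ((1 / sqrt (real n) * Z n \<omega>) * (1 / sqrt (real n) * Z n \<omega>)))"
  have "conv_in_prob M W (1 + (-1) * (0 * 0))"
    unfolding W_def
    by (intro conv_in_prob_add conv_in_prob_mult conv_in_prob_const[OF tendsto_const] conv1 conv2)
  then have convW: "conv_in_prob M W 1" by simp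
  have W: "W n \<omega> = (\<Sum>i=1..n. (Y i \<omega> - (\<Sum>k=1..n. Y k \<omega>) / real n)\<^sup>2) / (real n * (b n)\<^sup>2)"
    if "n > 0" for n \<omega>
  proof -
    have "(\<Sum>i=1..n. (Y i \<omega> - (\<Sum>k=1..n. Y k \<omega>) / real n)\<^sup>2)
      = (\<Sum>i=1..n. (Y i \<omega>)\<^sup>2) - real n * ((\<Sum>k=1..n. Y k \<omega>) / real n)\<^sup>2"
      using centred_sum_squares[OF that, of "\<lambda>i. Y i \<omega>" 0] by simp
    moreover have "real n * ((\<Sum>k=1..n. Y k \<omega>) / real n)\<^sup>2 / (real n * (b n)\<^sup>2)
      = (1 / sqrt (real n) * Z n \<omega>) * (1 / sqrt (real n) * Z n \<omega>)"
    proof -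
      have "1 / sqrt (real n) * Z n \<omega> = (\<Sum>k=1..n. Y k \<omega>) / (real n * b n)"
        using that by (simp add: Z_def)
      then show ?thesis using that by (simp add: power2_eq_square)
    qed
    ultimately show ?thesis by (simp add: W_def diff_divide_distrib)
  qed
  define v where "v = (\<lambda>n i \<omega>. point_avg m h (\<lambda>j. X j \<omega>) n i)"
  \<comment> \<open>The factor \<open>1 / c^2\<close> comes from replacing \<open>b n\<close> by its
    lower bound.\<close>
  define D where "D = (\<lambda>n \<omega>. (\<Sum>i=1..n. (v n i \<omega> - cmean h (X i \<omega>))\<^sup>2) / real n * (1 / c\<^sup>2))"
  have "conv_in_prob M D (0 * (1 / c\<^sup>2))"
    unfolding D_def v_def
    by (intro conv_in_prob_mult conv_in_prob_const[OF tendsto_const]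
        conv_in_prob_point_avg[OF h assms(6) int intp])
  then have convD: "conv_in_prob M D 0" by simp
  have rv_v: "v n i \<in> borel_measurable M" for n i
    unfolding v_def by (rule random_variable_point_avg[OF h])
  define V where "V = (\<lambda>n \<omega>. (\<Sum>i=1..n. (v n i \<omega> - (\<Sum>k=1..n. v n k \<omega>) / real n)\<^sup>2) / (real n * (b n)\<^sup>2))"
  have rvV: "V n \<in> borel_measurable M" for n
    unfolding V_def
    by (intro borel_measurable_divide borel_measurable_sum borel_measurable_power
        borel_measurable_diff rv_v borel_measurable_const)
  have convE: "conv_in_prob M (\<lambda>n \<omega>. D n \<omega> + 2 * (sqrt (W n \<omega>) * sqrt (D n \<omega>))) (0 + 2 * (sqrt 1 * sqrt 0))"
    by (intro conv_in_prob_add conv_in_prob_mult conv_in_prob_const[OF tendsto_const] convD convW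
        conv_in_prob_cont[where f=sqrt] isCont_real_sqrt borel_measurable_sqrt measurable_ident)
  have convVW: "conv_in_prob M (\<lambda>n \<omega>. V n \<omega> - W n \<omega>) 0"
  proof (rule conv_in_prob_dominated)
    show "conv_in_prob M (\<lambda>n \<omega>. D n \<omega> + 2 * (sqrt (W n \<omega>) * sqrt (D n \<omega>))) 0"
      using convE by simp
    show "\<forall>\<^sub>F n in sequentially. AE \<omega> in M. \<bar>V n \<omega> - W n \<omega> - 0\<bar> \<le> D n \<omega> + 2 * (sqrt (W n \<omega>) * sqrt (D n \<omega>))"
      using eventually_gt_at_top[of 0]
    proof eventually_elim
      case (elim n)
      have "AE \<omega> in M. \<forall>i\<in>{1..n}. Y i \<omega> = cmean h (X i \<omega>) - \<theta>"
        by (intro AE_finite_allI cm) auto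
      then show ?case
      proof eventually_elim
        case Y: (elim \<omega>)
        define s where "s = real n * (b n)\<^sup>2"
        define d where "d = (\<Sum>i=1..n. (v n i \<omega> - Y i \<omega> - \<theta>)\<^sup>2)"
        define sw where "sw = (\<Sum>i=1..n. (Y i \<omega> - (\<Sum>k=1..n. Y k \<omega>) / real n)\<^sup>2)"
        have s: "s > 0" using elim b0[of n] by (simp add: s_def)
        \<comment> \<open>Almost surely \<open>Y i + \<theta>\<close> is the conditional mean of the
          kernel, so \<theta> is the constant to use in the perturbation bound.\<close>
        have d: "d = (\<Sum>i=1..n. (v n i \<omega> - cmean h (X i \<omega>))\<^sup>2)"
          unfolding d_def using Y by (intro sum.cong refl) simp
        have d0: "d \<ge> 0" unfolding d_def by (intro sum_nonneg) auto
        have dD: "d / s \<le> D n \<omega>"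
        proof -
          have "d / s \<le> d / (real n * c\<^sup>2)"
            unfolding s_def using d0 c b[of n] elim
            by (intro divide_left_mono mult_left_mono power_mono) auto
          then show ?thesis by (simp add: D_def d)
        qed
        have "\<bar>V n \<omega> - W n \<omega>\<bar> = \<bar>(\<Sum>i=1..n. (v n i \<omega> - (\<Sum>k=1..n. v n k \<omega>) / real n)\<^sup>2) - sw\<bar> / s"
          using s elim by (simp add: V_def W s_def[symmetric] sw_def diff_divide_distrib[symmetric])
        also have "\<dots> \<le> (d + 2 * (sqrt sw * sqrt d)) / s"
          unfolding sw_def d_def using s
          by (intro divide_right_mono centred_sum_squares_perturb elim) auto
        also have "\<dots> = d / s + 2 * (sqrt (sw / s) * sqrt (d / s))"
          using s by (simp add: add_divide_distrib real_sqrt_divide)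
        also have "\<dots> \<le> D n \<omega> + 2 * (sqrt (sw / s) * sqrt (D n \<omega>))"
          using dD s by (intro add_mono mult_left_mono real_sqrt_le_mono)
            (auto simp: sw_def intro!: sum_nonneg divide_nonneg_pos)
        also have "sw / s = W n \<omega>" using elim by (simp add: W sw_def s_def)
        finally show ?case by simp
      qed
    qed
  qed (intro borel_measurable_diff rvV conv_in_prob_measurable[OF convW])
  have "conv_in_prob M (\<lambda>n \<omega>. (V n \<omega> - W n \<omega>) + W n \<omega>) (0 + 1)"
    by (intro conv_in_prob_add convVW convW)
  then have convV: "conv_in_prob M V 1" by simp
  \<comment> \<open>For \<open>n > m\<close> this equals \<open>n * (n - 1) / (n - m)^2\<close>, the
    factor left over from the jackknife identity, arranged so that its limit 1 is visible.\<close>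
  define a where "a = (\<lambda>n. (1 + real m / real (n - m)) * (1 + (real m - 1) / real (n - m)))"
  have null: "(\<lambda>n. x / real (n - m)) \<longlonglongrightarrow> 0" for x :: real
    by (intro tendsto_divide_0[OF tendsto_const] filterlim_at_top_imp_at_infinity
        filterlim_compose[OF filterlim_real_sequentially] filterlim_minus_const_nat_at_top)
  have "a \<longlonglongrightarrow> (1 + 0) * (1 + 0)"
    unfolding a_def by (intro tendsto_intros null)
  then have "conv_in_prob M (\<lambda>n \<omega>. a n * V n \<omega>) (1 * 1)"
    by (intro conv_in_prob_mult conv_in_prob_const convV) simp
  then have conv: "conv_in_prob M (\<lambda>n \<omega>. a n * V n \<omega>) 1" by simp
  have rvU: "(\<lambda>\<omega>. U_jack m h (\<lambda>j. X j \<omega>) n i) \<in> borel_measurable M"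
    "(\<lambda>\<omega>. U_stat m h (\<lambda>j. X j \<omega>) n) \<in> borel_measurable M" for n i
  proof -
    have "j \<in> {1..m} \<rightarrow> {1..}" if "j \<in> increasing_tuples m S" "S \<subseteq> {1..n}" for j S
      using that by (fastforce simp: increasing_tuples_def PiE_iff)
    then have "(\<lambda>\<omega>. h (\<lambda>k\<in>{1..m}. X (j k) \<omega>)) \<in> borel_measurable M"
      if "j \<in> increasing_tuples m S" "S \<subseteq> {1..n}" for j S
      using random_variable_kernel[OF h, of j] that unfolding tuple_def by blast
    then show "(\<lambda>\<omega>. U_jack m h (\<lambda>j. X j \<omega>) n i) \<in> borel_measurable M"
      "(\<lambda>\<omega>. U_stat m h (\<lambda>j. X j \<omega>) n) \<in> borel_measurable M"
      unfolding U_jack_def U_stat_def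
      by (intro borel_measurable_times borel_measurable_sum borel_measurable_const; blast)+
  qed
  show ?thesis
  proof (rule conv_in_prob_cong[OF _ conv])
    show "\<forall>\<^sub>F n in sequentially. \<forall>\<omega>\<in>space M. (real n - 1) / ((real m)\<^sup>2 * (l (real n))\<^sup>2) *
       (\<Sum>i=1..n. (U_jack m h (\<lambda>j. X j \<omega>) n i - U_stat m h (\<lambda>j. X j \<omega>) n)\<^sup>2) = a n * V n \<omega>"
      using eventually_gt_at_top[of m]
    proof (rule eventually_mono, intro ballI)
      fix n \<omega> assume n: "n > m"
      define sv where "sv = (\<Sum>i=1..n. (v n i \<omega> - (\<Sum>k=1..n. v n k \<omega>) / real n)\<^sup>2)"
      define e where "e = real n - real m"
      have e: "e > 0" "real (n - m) = e" using n by (auto simp: e_def of_nat_diff)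
      have pos: "real n > 0" "real m > 0" "l (real n) > 0" "b n = l (real n)"
        using n m lpos[of "real n"] by (auto simp: b_def)
      have "(\<Sum>i=1..n. (U_jack m h (\<lambda>j. X j \<omega>) n i - U_stat m h (\<lambda>j. X j \<omega>) n)\<^sup>2)
        = (\<Sum>i=1..n. (real m / e)\<^sup>2 * (v n i \<omega> - (\<Sum>k=1..n. v n k \<omega>) / real n)\<^sup>2)"
        unfolding e_def v_def
        by (intro sum.cong refl, subst U_jack_minus_U_stat[OF m n], assumption,
            simp only: power_mult_distrib, subst power2_commute, rule refl)
      also have "\<dots> = (real m / e)\<^sup>2 * sv" by (simp add: sv_def sum_distrib_left)
      finally have "(real n - 1) / ((real m)\<^sup>2 * (l (real n))\<^sup>2) *
         (\<Sum>i=1..n. (U_jack m h (\<lambda>j. X j \<omega>) n i - U_stat m h (\<lambda>j. X j \<omega>) n)\<^sup>2)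
         = (real n - 1) / ((real m)\<^sup>2 * (l (real n))\<^sup>2) * ((real m / e)\<^sup>2 * sv)" by simp
      also have "\<dots> = (real n / e * ((real n - 1) / e)) * (sv / (real n * (l (real n))\<^sup>2))"
        using pos e by (simp add: power2_eq_square)
      also have "real n / e = 1 + real m / e" using e(1) by (simp add: e_def field_simps)
      also have "(real n - 1) / e = 1 + (real m - 1) / e" using e(1) by (simp add: e_def field_simps)
      finally show "(real n - 1) / ((real m)\<^sup>2 * (l (real n))\<^sup>2) *
         (\<Sum>i=1..n. (U_jack m h (\<lambda>j. X j \<omega>) n i - U_stat m h (\<lambda>j. X j \<omega>) n)\<^sup>2) = a n * V n \<omega>"
        by (simp add: a_def V_def sv_def pos(4) e(2))
    qed
  qed (intro borel_measurable_times borel_measurable_const borel_measurable_sum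
      borel_measurable_power borel_measurable_diff rvU)
qed

end
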